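(* Let $d=1$, let $R$ be an integer with $|R|\ge2$, $B\subset\mathbb{Z}$ finite with $0\in B$, $N:=|B|$, such that $\mu=\mu(R,B)$ has no overlap. Let $L\subset\mathbb{Z}$ be finite with $0\in L$ and $(\alpha_l)_{l\in L}$ complex numbers with $\alpha_0=1$ such that the matrix $\frac{1}{\sqrt N}\left(e^{2\pi i lb/R}\alpha_l\right)_{l\in L,b\in B}$ has orthonormal columns. If the only finite minimal invariant set is $\{0\}$, then the only entire function $h$ on $\mathbb{C}$ with $0\le h\le1$ on $\mathbb{R}$, $h(0)=1$ and $\sum_{l\in L}|\alpha_l|^2|m_B((t-l)/R)|^2h((t-l)/R)=h(t)$ for all $t\in\mathbb{R}$ is the constant $1$, and therefore $$\left\{\Big(\prod_{i=0}^k\alpha_{l_i}\Big)e_{l_0+Rl_1+\dots+R^kl_k}: l_0\dots l_k\in\Omega(L)\right\}$$ is a Parseval frame for $L^2(\mu)$. Conversely, if there is a finite minimal invariant set $M\ne\{0\}$, then for every $c\in M$, $e_c$ is orthogonal in $L^2(\mu)$ to every element of this set (so the set is incomplete).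
   Context: $\tau_b(x)=(x+b)/R$; $\mu(R,B)$ is the unique Borel probability measure with $\mu(E)=\frac1N\sum_b\mu(\tau_b^{-1}(E))$, supported on the attractor $X_B=\bigcup_b\tau_b(X_B)$; no overlap means $\mu(\tau_b(X_B)\cap\tau_{b'}(X_B))=0$ for $b\ne b'$. $e_\lambda(x)=e^{2\pi i\lambda x}$, $m_B(x)=\frac1N\sum_{b\in B}e^{2\pi ibx}$, $g_l(t)=(t-l)/R$. A set $M\subset\mathbb{R}$ is invariant if for all $t\in M$ and $l\in L$ with $\alpha_lm_B(g_l(t))\ne0$ we have $g_l(t)\in M$; a finite minimal invariant set is a nonempty finite invariant set with no proper nonempty invariant subset. $\Omega(L)$: the empty word (giving $e_0$ with weight 1) and all words $l_0\dots l_k$ with $l_i\in L$, $l_k\ne0$. Parseval frame: $\sum_i|\langle v,f_i\rangle|^2=\|v\|^2$ for all $v$. *)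

theory Defs
  imports "HOL-Analysis.Analysis" "HOL-Probability.Probability"
begin

definition expo :: "real \<Rightarrow> real \<Rightarrow> complex" where
  "expo lam x = exp (2 * complex_of_real pi * \<i> * complex_of_real (lam * x))"

definition tau :: "int \<Rightarrow> int \<Rightarrow> real \<Rightarrow> real" where
  "tau R b x = (x + real_of_int b) / real_of_int R"

definition mB :: "int set \<Rightarrow> real \<Rightarrow> complex" where
  "mB B x = (1 / of_nat (card B)) * (\<Sum>b\<in>B. expo (real_of_int b) x)"

definition gl :: "int \<Rightarrow> int \<Rightarrow> real \<Rightarrow> real" where
  "gl R l t = (t - real_of_int l) / real_of_int R"

definition invariant_measure :: "int \<Rightarrow> int set \<Rightarrow> real measure \<Rightarrow> bool" where
  "invariant_measure R B \<mu> \<longleftrightarrow> prob_space \<mu> \<and> sets \<mu> = sets borel \<and>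
     (\<forall>E\<in>sets borel. measure \<mu> E =
        (1 / real (card B)) * (\<Sum>b\<in>B. measure \<mu> (tau R b -` E)))"

definition attractor :: "int \<Rightarrow> int set \<Rightarrow> real set \<Rightarrow> bool" where
  "attractor R B X \<longleftrightarrow> compact X \<and> X \<noteq> {} \<and> X = (\<Union>b\<in>B. tau R b ` X)"

definition no_overlap :: "int \<Rightarrow> int set \<Rightarrow> real measure \<Rightarrow> bool" where
  "no_overlap R B \<mu> \<longleftrightarrow> (\<forall>X. attractor R B X \<longrightarrow>
     (\<forall>b\<in>B. \<forall>b'\<in>B. b \<noteq> b' \<longrightarrow> measure \<mu> (tau R b ` X \<inter> tau R b' ` X) = 0))"

definition invariant_set :: "int \<Rightarrow> int set \<Rightarrow> int set \<Rightarrow> (int \<Rightarrow> complex) \<Rightarrow> real set \<Rightarrow> bool" where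
  "invariant_set R B L \<alpha> M \<longleftrightarrow> (\<forall>t\<in>M. \<forall>l\<in>L.
     \<alpha> l * mB B (gl R l t) \<noteq> 0 \<longrightarrow> gl R l t \<in> M)"

definition finite_minimal_invariant :: "int \<Rightarrow> int set \<Rightarrow> int set \<Rightarrow> (int \<Rightarrow> complex) \<Rightarrow> real set \<Rightarrow> bool" where
  "finite_minimal_invariant R B L \<alpha> M \<longleftrightarrow> finite M \<and> M \<noteq> {} \<and> invariant_set R B L \<alpha> M \<and>
     (\<forall>M'. M' \<subset> M \<and> M' \<noteq> {} \<longrightarrow> \<not> invariant_set R B L \<alpha> M')"

definition Omega :: "int set \<Rightarrow> int list set" where
  "Omega L = {w. set w \<subseteq> L \<and> (w = [] \<or> last w \<noteq> 0)}"

fun freq :: "int \<Rightarrow> int list \<Rightarrow> int" where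
  "freq R [] = 0"
| "freq R (l # ls) = l + R * freq R ls"

definition frame_elem :: "int \<Rightarrow> (int \<Rightarrow> complex) \<Rightarrow> int list \<Rightarrow> real \<Rightarrow> complex" where
  "frame_elem R \<alpha> w x = prod_list (map \<alpha> w) * expo (real_of_int (freq R w)) x"

definition L2 :: "real measure \<Rightarrow> (real \<Rightarrow> complex) set" where
  "L2 \<mu> = {f. f \<in> borel_measurable \<mu> \<and> integrable \<mu> (\<lambda>x. (cmod (f x))\<^sup>2)}"

definition L2_inner :: "real measure \<Rightarrow> (real \<Rightarrow> complex) \<Rightarrow> (real \<Rightarrow> complex) \<Rightarrow> complex" where
  "L2_inner \<mu> f g = (\<integral>x. f x * cnj (g x) \<partial>\<mu>)"

definition L2_normsq :: "real measure \<Rightarrow> (real \<Rightarrow> complex) \<Rightarrow> real" where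
  "L2_normsq \<mu> f = (\<integral>x. (cmod (f x))\<^sup>2 \<partial>\<mu>)"

definition parseval_frame :: "real measure \<Rightarrow> 'i set \<Rightarrow> ('i \<Rightarrow> real \<Rightarrow> complex) \<Rightarrow> bool" where
  "parseval_frame \<mu> I F \<longleftrightarrow> (\<forall>f\<in>L2 \<mu>.
     ((\<lambda>i. (cmod (L2_inner \<mu> f (F i)))\<^sup>2) has_sum L2_normsq \<mu> f) I)"

end

theory Submission
  imports Defs "HOL-Complex_Analysis.Complex_Analysis"
begin

text \<open>
  Let \<open>S l\<close> denote \<open>cuntz_adjoint l\<close>, the adjoint of \<open>f \<mapsto> \<alpha> l * e\<^bsub>l\<^esub> * (f \<circ> \<sigma>)\<close>, where
  \<open>\<sigma> \<circ> tau R b = id\<close>. Orthonormality of the columns gives \<open>\<Sum>l. \<parallel>S l f\<parallel>\<^sup>2 = \<parallel>f\<parallel>\<^sup>2\<close>, and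
  \<open>\<langle>f, f\<^bsub>l w\<^esub>\<rangle> = \<langle>S l f, f\<^bsub>w\<^esub>\<rangle>\<close>, so the system satisfies the Bessel inequality. Since \<open>S l e\<^bsub>t\<^esub>\<close> is
  a multiple of \<open>e\<^bsub>s\<^esub>\<close> with \<open>s = g\<^bsub>l\<^esub>(t)\<close>, the function \<open>h(t) = \<Sum>w. |\<langle>e\<^bsub>t\<^esub>, f\<^bsub>w\<^esub>\<rangle>|\<^sup>2\<close> is a fixed
  point of the transfer operator; it extends to an entire function by Montel's theorem because the
  measure has compact support. The minimum set of an entire fixed point on a compact interval is
  invariant, hence infinite if \<open>{0}\<close> is the only finite minimal invariant set, and then \<open>h = 1\<close>.
  So all exponentials satisfy Parseval's identity. By the Bessel inequality the functions that do
  form a closed subspace of \<open>L\<^sup>2(\<mu>)\<close>, and by Stone--Weierstrass it is everything.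
\<close>

section \<open>Square-integrable functions\<close>

lemma cmod_parallelogram: "(cmod (a + b))\<^sup>2 + (cmod (a - b))\<^sup>2 = 2 * (cmod a)\<^sup>2 + 2 * (cmod b)\<^sup>2"
  by (simp add: cmod_power2 power2_sum power2_diff)

lemma cnj_measurable [measurable]: "cnj \<in> borel_measurable borel"
  by (intro borel_measurable_continuous_onI continuous_intros)

lemma L2_measurable [measurable_dest]: "f \<in> L2 \<mu> \<Longrightarrow> f \<in> borel_measurable \<mu>"
  by (simp add: L2_def)

lemma L2_integrable: "f \<in> L2 \<mu> \<Longrightarrow> integrable \<mu> (\<lambda>x. (cmod (f x))\<^sup>2)"
  by (simp add: L2_def)

lemma L2_add:
  assumes [measurable]: "f \<in> L2 \<mu>" "g \<in> L2 \<mu>"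
  shows "(\<lambda>x. f x + g x) \<in> L2 \<mu>"
proof -
  have "(cmod (f x + g x))\<^sup>2 \<le> 2 * (cmod (f x))\<^sup>2 + 2 * (cmod (g x))\<^sup>2" for x
    using cmod_parallelogram[of "f x" "g x"] zero_le_power2[of "cmod (f x - g x)"] by linarith
  moreover have "integrable \<mu> (\<lambda>x. 2 * (cmod (f x))\<^sup>2 + 2 * (cmod (g x))\<^sup>2)"
    by (intro Bochner_Integration.integrable_add integrable_mult_right L2_integrable assms)
  ultimately have "integrable \<mu> (\<lambda>x. (cmod (f x + g x))\<^sup>2)"
    by (elim Bochner_Integration.integrable_bound) auto
  then show ?thesis by (simp add: L2_def)
qed

lemma L2_scale:
  assumes [measurable]: "f \<in> L2 \<mu>"
  shows "(\<lambda>x. c * f x) \<in> L2 \<mu>"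
  using L2_integrable[OF assms] by (simp add: L2_def norm_mult power_mult_distrib)

lemma L2_diff:
  assumes "f \<in> L2 \<mu>" "g \<in> L2 \<mu>"
  shows "(\<lambda>x. f x - g x) \<in> L2 \<mu>"
  using L2_add[OF assms(1) L2_scale[OF assms(2), of "-1"]] by simp

lemma L2_zero: "(\<lambda>_. 0) \<in> L2 \<mu>"
  by (simp add: L2_def)

lemma L2_sum: "(\<And>i. i \<in> A \<Longrightarrow> f i \<in> L2 \<mu>) \<Longrightarrow> (\<lambda>x. \<Sum>i\<in>A. f i x) \<in> L2 \<mu>"
  by (induction A rule: infinite_finite_induct) (simp_all add: L2_zero L2_add)

lemma L2_bounded:
  assumes "finite_measure \<mu>" and [measurable]: "f \<in> borel_measurable \<mu>"
    and bound: "AE x in \<mu>. cmod (f x) \<le> C"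
  shows "f \<in> L2 \<mu>"
proof -
  interpret finite_measure \<mu> by fact
  have "AE x in \<mu>. norm ((cmod (f x))\<^sup>2) \<le> C\<^sup>2"
    using bound by eventually_elim (simp add: power_mono)
  then have "integrable \<mu> (\<lambda>x. (cmod (f x))\<^sup>2)"
    by (intro integrable_const_bound) auto
  then show ?thesis by (simp add: L2_def)
qed

lemma L2_inner_integrable:
  assumes [measurable]: "f \<in> L2 \<mu>" "g \<in> L2 \<mu>"
  shows "integrable \<mu> (\<lambda>x. f x * cnj (g x))"
proof -
  have "integrable \<mu> (\<lambda>x. (cmod (f x))\<^sup>2 + (cmod (g x))\<^sup>2)"
    by (intro Bochner_Integration.integrable_add L2_integrable assms)
  moreover have "cmod (f x) * cmod (g x) \<le> (cmod (f x))\<^sup>2 + (cmod (g x))\<^sup>2" for x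
    using sum_squares_bound[of "cmod (f x)" "cmod (g x)"]
      mult_nonneg_nonneg[OF norm_ge_zero[of "f x"] norm_ge_zero[of "g x"]] by linarith
  ultimately show ?thesis
    by (elim Bochner_Integration.integrable_bound) (auto simp: norm_mult)
qed

lemma L2_inner_add_left:
  assumes "f \<in> L2 \<mu>" "g \<in> L2 \<mu>" "k \<in> L2 \<mu>"
  shows "L2_inner \<mu> (\<lambda>x. f x + g x) k = L2_inner \<mu> f k + L2_inner \<mu> g k"
  using assms by (simp add: L2_inner_def ring_distribs L2_inner_integrable)

lemma L2_inner_diff_left:
  assumes "f \<in> L2 \<mu>" "g \<in> L2 \<mu>" "k \<in> L2 \<mu>"
  shows "L2_inner \<mu> (\<lambda>x. f x - g x) k = L2_inner \<mu> f k - L2_inner \<mu> g k"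
  using assms by (simp add: L2_inner_def left_diff_distrib L2_inner_integrable)

lemma L2_inner_scale_left: "L2_inner \<mu> (\<lambda>x. c * f x) k = c * L2_inner \<mu> f k"
  by (simp add: L2_inner_def mult.assoc)

lemma L2_normsq_scale: "L2_normsq \<mu> (\<lambda>x. c * f x) = (cmod c)\<^sup>2 * L2_normsq \<mu> f"
  by (simp add: L2_normsq_def norm_mult power_mult_distrib)

lemma L2_normsq_parallelogram:
  assumes "f \<in> L2 \<mu>" "g \<in> L2 \<mu>"
  shows "L2_normsq \<mu> (\<lambda>x. f x + g x) + L2_normsq \<mu> (\<lambda>x. f x - g x)
    = 2 * L2_normsq \<mu> f + 2 * L2_normsq \<mu> g"
proof -
  have "L2_normsq \<mu> (\<lambda>x. f x + g x) + L2_normsq \<mu> (\<lambda>x. f x - g x)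
    = (\<integral>x. 2 * (cmod (f x))\<^sup>2 + 2 * (cmod (g x))\<^sup>2 \<partial>\<mu>)"
    unfolding L2_normsq_def cmod_parallelogram[symmetric]
    by (intro Bochner_Integration.integral_add[symmetric] L2_integrable L2_add L2_diff assms)
  then show ?thesis
    using assms by (simp add: L2_normsq_def L2_integrable)
qed

lemma L2_inner_one_le:
  assumes "prob_space \<mu>" and f: "f \<in> L2 \<mu>"
  shows "(cmod (L2_inner \<mu> f (\<lambda>_. 1)))\<^sup>2 \<le> L2_normsq \<mu> f"
proof -
  interpret prob_space \<mu> by fact
  have int: "integrable \<mu> f"
    using L2_inner_integrable[OF f L2_bounded[OF finite_measure_axioms, of "\<lambda>_. 1" 1]] by simp
  have "cmod (L2_inner \<mu> f (\<lambda>_. 1)) \<le> expectation (\<lambda>x. cmod (f x))"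
    unfolding L2_inner_def using integral_norm_bound[of \<mu> f] by simp
  then have "(cmod (L2_inner \<mu> f (\<lambda>_. 1)))\<^sup>2 \<le> (expectation (\<lambda>x. cmod (f x)))\<^sup>2"
    by (intro power_mono) auto
  also have "\<dots> \<le> L2_normsq \<mu> f"
    using variance_eq[OF integrable_norm[OF int] L2_integrable[OF f]]
      variance_positive[of "\<lambda>x. cmod (f x)"]
    by (simp add: L2_normsq_def)
  finally show ?thesis .
qed

locale closed_L2_subspace =
  fixes \<mu> :: "real measure" and V :: "(real \<Rightarrow> complex) set"
  assumes subset_L2: "V \<subseteq> L2 \<mu>"
    and scale_mem: "f \<in> V \<Longrightarrow> (\<lambda>x. c * f x) \<in> V"
    and add_mem: "f \<in> V \<Longrightarrow> g \<in> V \<Longrightarrow> (\<lambda>x. f x + g x) \<in> V"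
    and limit_mem: "f \<in> L2 \<mu> \<Longrightarrow> (\<And>n::nat. s n \<in> V) \<Longrightarrow>
      (\<lambda>n. L2_normsq \<mu> (\<lambda>x. f x - s n x)) \<longlonglongrightarrow> 0 \<Longrightarrow> f \<in> V"
begin

lemma sum_mem:
  assumes "finite A" "A \<noteq> {}" "\<And>i. i \<in> A \<Longrightarrow> f i \<in> V"
  shows "(\<lambda>x. \<Sum>i\<in>A. f i x) \<in> V"
  using assms by (induction A rule: finite_ne_induct) (auto intro: add_mem)

lemma dominated_limit_mem:
  assumes f: "f \<in> L2 \<mu>" and s: "\<And>n::nat. s n \<in> V"
    and lim: "AE x in \<mu>. (\<lambda>n. s n x) \<longlonglongrightarrow> f x"
    and bound: "\<And>n. AE x in \<mu>. cmod (f x - s n x) \<le> k x"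
    and k: "integrable \<mu> (\<lambda>x. (k x)\<^sup>2)"
  shows "f \<in> V"
proof (rule limit_mem[OF f s])
  have sL: "s n \<in> L2 \<mu>" for n using s subset_L2 by blast
  have "(\<lambda>n. \<integral>x. (cmod (f x - s n x))\<^sup>2 \<partial>\<mu>) \<longlonglongrightarrow> (\<integral>x. 0 \<partial>\<mu>)"
  proof (rule integral_dominated_convergence[OF _ _ k])
    show "AE x in \<mu>. (\<lambda>n. (cmod (f x - s n x))\<^sup>2) \<longlonglongrightarrow> 0"
      using lim by eventually_elim (auto intro!: tendsto_eq_intros)
    show "AE x in \<mu>. norm ((cmod (f x - s n x))\<^sup>2) \<le> (k x)\<^sup>2" for n
      using bound[of n] by eventually_elim (simp add: power_mono)
    show "(\<lambda>x. (cmod (f x - s n x))\<^sup>2) \<in> borel_measurable \<mu>" for n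
      using L2_integrable[OF L2_diff[OF f sL]] by (rule borel_measurable_integrable)
  qed simp
  then show "(\<lambda>n. L2_normsq \<mu> (\<lambda>x. f x - s n x)) \<longlonglongrightarrow> 0" by (simp add: L2_normsq_def)
qed

end

lemma compact_inner_approximation:
  fixes M :: "'a::{second_countable_topology, complete_space} measure"
  assumes M: "finite_measure M" "sets M = sets borel" and A: "A \<in> sets borel" and e: "e > 0"
  obtains K where "K \<subseteq> A" "compact K" "measure M (A - K) < e"
proof -
  interpret finite_measure M by (rule M(1))
  have Sup: "emeasure M A = (SUP K\<in>{K. K \<subseteq> A \<and> compact K}. emeasure M K)"
    by (rule inner_regular[OF M(2) _ A]) simp
  have "\<exists>K\<in>{K. K \<subseteq> A \<and> compact K}. emeasure M A < emeasure M K + ennreal e"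
    by (rule SUP_approx_ennreal[OF e _ Sup]) auto
  then obtain K where K: "K \<subseteq> A" "compact K" "emeasure M A < emeasure M K + ennreal e" by blast
  have "ennreal (measure M A) < ennreal (measure M K + e)"
    using K(3) e by (simp add: emeasure_eq_measure)
  then have "measure M A < measure M K + e"
    by (simp add: ennreal_less_iff del: ennreal_plus)
  moreover have "measure M (A - K) = measure M A - measure M K"
    using A K(1) compact_imp_closed[OF K(2)] by (intro finite_measure_Diff) (auto simp: M(2))
  ultimately show ?thesis using K(1,2) by (intro that) auto
qed

lemma infdist_power_tendsto_indicator:
  fixes K :: "'a::metric_space set"
  assumes "closed K" "K \<noteq> {}"
  shows "(\<lambda>n. inverse (1 + infdist x K) ^ n) \<longlonglongrightarrow> indicator K x"
proof (cases "x \<in> K")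
  case False
  then have "infdist x K > 0" using assms by (intro infdist_pos_not_in_closed)
  then have "norm (inverse (1 + infdist x K)) < 1" by (simp add: field_simps)
  then show ?thesis using False by (simp add: LIMSEQ_power_zero)
qed simp

section \<open>Exponentials and their density\<close>

lemma expo_0 [simp]: "expo 0 x = 1" "expo t 0 = 1"
  by (simp_all add: expo_def)

lemma expo_add: "expo (s + t) x = expo s x * expo t x"
  by (simp add: expo_def exp_add[symmetric] algebra_simps)

lemma expo_add_arg: "expo t (x + y) = expo t x * expo t y"
  by (simp add: expo_def exp_add[symmetric] algebra_simps)

lemma expo_commute: "expo t x = expo x t"
  by (simp add: expo_def mult.commute)

lemma expo_divide: "expo t (x / c) = expo (t / c) x"
  by (simp add: expo_def)

lemma cnj_expo: "cnj (expo t x) = expo (- t) x"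
  by (simp add: expo_def exp_cnj)

lemma norm_expo [simp]: "cmod (expo t x) = 1"
  by (simp add: expo_def)

lemma expo_of_int: "expo (of_int k) (of_int m) = 1"
proof -
  have "expo (of_int k) (of_int m) = exp (complex_of_real (2 * of_int (k * m) * pi) * \<i>)"
    by (simp add: expo_def mult_ac)
  also have "\<dots> = 1" by (rule exp_integer_2pi) simp
  finally show ?thesis .
qed

lemma continuous_on_expo [continuous_intros]: "continuous_on S (expo t)"
  unfolding expo_def by (intro continuous_intros)

lemma expo_measurable [measurable]: "expo t \<in> borel_measurable borel"
  by (intro borel_measurable_continuous_onI continuous_intros)

inductive trig_poly :: "(real \<Rightarrow> complex) \<Rightarrow> bool" where
  trig_poly_expo: "trig_poly (expo t)"
| trig_poly_scale: "trig_poly p \<Longrightarrow> trig_poly (\<lambda>x. c * p x)"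
| trig_poly_add: "trig_poly p \<Longrightarrow> trig_poly q \<Longrightarrow> trig_poly (\<lambda>x. p x + q x)"

lemma trig_poly_const: "trig_poly (\<lambda>_. c)"
  using trig_poly_scale[OF trig_poly_expo[of 0], of c] by simp

lemma trig_poly_expo_mult: "trig_poly p \<Longrightarrow> trig_poly (\<lambda>x. expo t x * p x)"
proof (induction rule: trig_poly.induct)
  case (trig_poly_expo s)
  then show ?case using trig_poly.trig_poly_expo[of "t + s"] by (simp add: expo_add[abs_def])
next
  case (trig_poly_scale p c)
  then show ?case
    using trig_poly.trig_poly_scale[of "\<lambda>x. expo t x * p x" c] by (simp add: mult.left_commute)
next
  case (trig_poly_add p q)
  then show ?case by (simp add: ring_distribs trig_poly.trig_poly_add)
qed

lemma trig_poly_mult: "trig_poly p \<Longrightarrow> trig_poly q \<Longrightarrow> trig_poly (\<lambda>x. p x * q x)"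
proof (induction rule: trig_poly.induct)
  case (trig_poly_scale p c)
  then show ?case
    using trig_poly.trig_poly_scale[of "\<lambda>x. p x * q x" c] by (simp add: mult.assoc)
qed (simp_all add: trig_poly_expo_mult ring_distribs trig_poly_add)

lemma continuous_on_trig_poly: "trig_poly p \<Longrightarrow> continuous_on S p"
  by (induction rule: trig_poly.induct) (auto intro: continuous_intros)

lemma trig_poly_sin: "trig_poly (\<lambda>x. complex_of_real (sin (2 * pi * t * (x - y))))"
proof -
  have "complex_of_real (sin (2 * pi * t * (x - y)))
      = (-\<i>/2 * expo t (-y)) * expo t x + (\<i>/2 * expo (-t) (-y)) * expo (-t) x" for x
  proof -
    have "complex_of_real (sin (2 * pi * t * (x - y)))
        = -\<i>/2 * expo t (x + (-y)) + \<i>/2 * expo (-t) (x + (-y))"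
      unfolding sin_of_real[symmetric] by (simp add: sin_exp_eq expo_def field_simps)
    then show ?thesis unfolding expo_add_arg by (simp add: algebra_simps)
  qed
  then show ?thesis
    using trig_poly_add[OF trig_poly_scale[OF trig_poly_expo] trig_poly_scale[OF trig_poly_expo]]
    by presburger
qed

lemma trig_poly_uniform_dense:
  fixes u :: "real \<Rightarrow> real"
  assumes "compact K" "continuous_on K u" "e > 0"
  obtains p where "trig_poly p" "\<And>x. x \<in> K \<Longrightarrow> cmod (complex_of_real (u x) - p x) < e"
proof -
  let ?P = "\<lambda>f. trig_poly (\<lambda>x::real. complex_of_real (f x))"
  have "\<exists>g. ?P g \<and> (\<forall>x\<in>K. \<bar>u x - g x\<bar> < e)"
  proof (rule Stone_Weierstrass_HOL)
    show "?P (\<lambda>x. c)" for c by (rule trig_poly_const)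
    show "continuous_on K f" if "?P f" for f
      using continuous_on_Re[OF continuous_on_trig_poly[OF that]] by simp
    show "?P (\<lambda>x. f x + g x)" if "?P f \<and> ?P g" for f g
      using that trig_poly_add[of "\<lambda>x. complex_of_real (f x)" "\<lambda>x. complex_of_real (g x)"] by simp
    show "?P (\<lambda>x. f x * g x)" if "?P f \<and> ?P g" for f g
      using that trig_poly_mult[of "\<lambda>x. complex_of_real (f x)" "\<lambda>x. complex_of_real (g x)"] by simp
    show "\<exists>f. ?P f \<and> f x \<noteq> f y" if "x \<in> K \<and> y \<in> K \<and> x \<noteq> y" for x y
    proof -
      define t where "t = 1 / (4 * (x - y))"
      have "2 * pi * t * (x - y) = pi / 2" using that by (simp add: t_def field_simps)
      then have "sin (2 * pi * t * (x - y)) \<noteq> sin (2 * pi * t * (y - y))"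
        by (metis diff_self mult_zero_right sin_pi_half sin_zero zero_neq_one)
      then show ?thesis
        using trig_poly_sin by (intro exI[of _ "\<lambda>z. sin (2 * pi * t * (z - y))"]) auto
    qed
  qed (use assms in auto)
  then obtain g where g: "?P g" "\<forall>x\<in>K. \<bar>u x - g x\<bar> < e" by blast
  have "cmod (complex_of_real (u x) - complex_of_real (g x)) < e" if "x \<in> K" for x
    using g(2) that by (metis norm_of_real of_real_diff)
  with g(1) show ?thesis by (rule that)
qed

locale compactly_supported_measure = finite_measure \<mu> for \<mu> :: "real measure" +
  fixes r :: real
  assumes sets_borel [measurable_cong]: "sets \<mu> = sets borel"
    and support: "AE x in \<mu>. \<bar>x\<bar> \<le> r"
begin

lemma space_UNIV [simp]: "space \<mu> = UNIV"
  using sets_eq_imp_space_eq[OF sets_borel] by simp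

lemma borel_measurable_eq: "borel_measurable \<mu> = borel_measurable borel"
  using sets_borel by (rule measurable_cong_sets) simp

lemma expo_L2: "expo t \<in> L2 \<mu>"
  by (rule L2_bounded[OF finite_measure_axioms, where C = 1]) auto

lemma one_L2: "(\<lambda>_. 1) \<in> L2 \<mu>"
  using expo_L2[of 0] by (simp add: expo_0[abs_def])

lemma continuous_L2:
  assumes "continuous_on UNIV f"
  shows "f \<in> L2 \<mu>"
proof -
  have "bounded (f ` {-r..r})"
    by (intro compact_imp_bounded compact_continuous_image continuous_on_subset[OF assms]) auto
  then obtain C where C: "\<And>x. x \<in> {-r..r} \<Longrightarrow> cmod (f x) \<le> C" unfolding bounded_iff by blast
  have [measurable]: "f \<in> borel_measurable borel"
    using assms by (rule borel_measurable_continuous_onI)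
  have "AE x in \<mu>. cmod (f x) \<le> C"
    using support
  proof eventually_elim
    case (elim x)
    then show ?case by (intro C) auto
  qed
  then show ?thesis by (intro L2_bounded finite_measure_axioms) auto
qed

lemma indicator_L2: "A \<in> sets borel \<Longrightarrow> indicator A \<in> L2 \<mu>"
  by (rule L2_bounded[OF finite_measure_axioms, where C = 1]) (auto simp: indicator_def)

end

locale exponential_subspace = compactly_supported_measure \<mu> r + closed_L2_subspace \<mu> V
  for \<mu> :: "real measure" and r :: real and V :: "(real \<Rightarrow> complex) set" +
  assumes expo_mem: "expo t \<in> V"
begin

lemma trig_poly_mem: "trig_poly p \<Longrightarrow> p \<in> V"
  by (induction rule: trig_poly.induct) (auto intro: expo_mem scale_mem add_mem)

lemma continuous_mem:
  fixes u :: "real \<Rightarrow> real"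
  assumes u: "continuous_on UNIV u"
  shows "(\<lambda>x. complex_of_real (u x)) \<in> V"
proof -
  have "\<exists>p. trig_poly p \<and> (\<forall>x\<in>{-r..r}. cmod (complex_of_real (u x) - p x) < inverse (Suc n))" for n
    using trig_poly_uniform_dense[OF compact_Icc continuous_on_subset[OF u]]
    by (metis inverse_positive_iff_positive of_nat_0_less_iff subset_UNIV zero_less_Suc)
  then obtain p where p: "\<And>n. trig_poly (p n)"
    "\<And>n x. x \<in> {-r..r} \<Longrightarrow> cmod (complex_of_real (u x) - p n x) < inverse (Suc n)" by metis
  show ?thesis
  proof (rule dominated_limit_mem)
    show "(\<lambda>x. complex_of_real (u x)) \<in> L2 \<mu>"
      by (intro continuous_L2 continuous_intros u)
    show "p n \<in> V" for n by (rule trig_poly_mem[OF p(1)])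
    show "AE x in \<mu>. (\<lambda>n. p n x) \<longlonglongrightarrow> complex_of_real (u x)"
      using support
    proof eventually_elim
      case (elim x)
      then have "x \<in> {-r..r}" by auto
      then have "\<forall>\<^sub>F n in sequentially. norm (p n x - complex_of_real (u x)) \<le> inverse (Suc n)"
        using p(2) by (intro always_eventually allI less_imp_le) (simp add: norm_minus_commute)
      then show ?case
        by (rule LIM_zero_cancel[OF Lim_null_comparison[OF _ LIMSEQ_inverse_real_of_nat]])
    qed
    show "AE x in \<mu>. cmod (complex_of_real (u x) - p n x) \<le> 1" for n
      using support
    proof eventually_elim
      case (elim x)
      then have "cmod (complex_of_real (u x) - p n x) < inverse (Suc n)" by (intro p(2)) auto
      also have "\<dots> \<le> 1" by (simp add: field_simps)
      finally show ?case by simp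
    qed
  qed simp
qed

lemma indicator_compact_mem:
  assumes K: "compact K"
  shows "indicator K \<in> V"
proof (cases "K = {}")
  case True
  then show ?thesis
    using trig_poly_mem[OF trig_poly_const[of 0]] by (simp add: indicator_def[abs_def])
next
  case False
  define s where "s n x = inverse (1 + infdist x K) ^ n" for n x
  show ?thesis
  proof (rule dominated_limit_mem)
    show "indicator K \<in> L2 \<mu>" using compact_imp_closed[OF K] by (intro indicator_L2) auto
    have "1 + infdist x K \<noteq> 0" for x using infdist_nonneg[of x K] by linarith
    then show "(\<lambda>x. complex_of_real (s n x)) \<in> V" for n
      unfolding s_def by (intro continuous_mem continuous_intros) auto
    have "(\<lambda>n. s n x) \<longlonglongrightarrow> indicator K x" for x
      unfolding s_def using compact_imp_closed[OF K] False by (rule infdist_power_tendsto_indicator)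
    from tendsto_of_real[OF this, where 'a = complex]
    show "AE x in \<mu>. (\<lambda>n. complex_of_real (s n x)) \<longlonglongrightarrow> indicator K x"
      by (simp add: of_real_indicator)
    show "AE x in \<mu>. cmod (indicator K x - complex_of_real (s n x)) \<le> 1" for n
    proof (rule AE_I2)
      fix x
      have "0 \<le> s n x" "s n x \<le> 1"
        unfolding s_def using infdist_nonneg[of x K]
        by (auto intro!: power_le_one simp: inverse_le_1_iff)
      moreover have "indicator K x - complex_of_real (s n x) = of_real (indicator K x - s n x)"
        by (simp add: of_real_indicator)
      ultimately show "cmod (indicator K x - complex_of_real (s n x)) \<le> 1"
        by (simp add: norm_of_real indicator_def del: of_real_diff)
    qed
  qed simp
qed

lemma indicator_mem:
  assumes A: "A \<in> sets borel"
  shows "indicator A \<in> V"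
proof -
  have "\<exists>K\<subseteq>A. compact K \<and> measure \<mu> (A - K) < inverse (Suc n)" for n :: nat
    using finite_measure_axioms sets_borel A
    by (rule compact_inner_approximation[of \<mu> A "inverse (Suc n)"]) (simp, blast)
  then obtain K where K: "\<And>n::nat. K n \<subseteq> A" "\<And>n. compact (K n)"
    "\<And>n. measure \<mu> (A - K n) < inverse (Suc n)" by metis
  show ?thesis
  proof (rule limit_mem[OF indicator_L2[OF A] indicator_compact_mem[OF K(2)]])
    have "(cmod (indicator A x - indicator (K n) x))\<^sup>2 = indicator (A - K n) x" for n x
      using K(1)[of n] by (auto simp: indicator_def)
    moreover have "K n \<in> sets borel" for n
      using compact_imp_closed[OF K(2)] by (intro borel_closed)
    ultimately have "L2_normsq \<mu> (\<lambda>x. indicator A x - indicator (K n) x)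
        = measure \<mu> (A - K n)" for n
      using A by (simp add: L2_normsq_def sets_borel)
    then show "(\<lambda>n. L2_normsq \<mu> (\<lambda>x. indicator A x - indicator (K n) x)) \<longlonglongrightarrow> 0"
      using K(3)
      by (intro tendsto_sandwich[OF _ _ tendsto_const LIMSEQ_inverse_real_of_nat]
          always_eventually allI) (auto intro: less_imp_le)
  qed
qed

lemma simple_function_mem:
  assumes s: "simple_function \<mu> s"
  shows "s \<in> V"
proof -
  have "(\<lambda>x. \<Sum>y\<in>range s. y * indicator (s -` {y}) x) \<in> V"
    using simple_functionD[OF s] by (intro sum_mem scale_mem indicator_mem) (auto simp: sets_borel)
  moreover have "(\<lambda>x. \<Sum>y\<in>range s. y * indicator (s -` {y}) x) = s"
  proof
    show "(\<Sum>y\<in>range s. y * indicator (s -` {y}) x) = s x" for x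
      using simple_function_indicator_representation_banach[OF s, of x]
      by (simp only: space_UNIV UNIV_I Int_UNIV_right scaleR_conv_of_real of_real_indicator
          mult.commute)
  qed
  ultimately show ?thesis by metis
qed

theorem eq_L2: "V = L2 \<mu>"
proof
  show "L2 \<mu> \<subseteq> V"
  proof
    fix f assume f: "f \<in> L2 \<mu>"
    from borel_measurable_implies_sequence_metric[OF L2_measurable[OF f], of 0]
    obtain s where s: "\<And>i. simple_function \<mu> (s i)" "\<And>x. (\<lambda>i. s i x) \<longlonglongrightarrow> f x"
      "\<And>i x. cmod (s i x) \<le> 2 * cmod (f x)"
      by (auto simp: dist_norm)
    show "f \<in> V"
    proof (rule dominated_limit_mem[where s = s, OF f simple_function_mem[OF s(1)]])
      show "AE x in \<mu>. cmod (f x - s n x) \<le> 3 * cmod (f x)" for n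
      proof (rule AE_I2)
        fix x
        show "cmod (f x - s n x) \<le> 3 * cmod (f x)"
          using norm_triangle_ineq4[of "f x" "s n x"] s(3)[of n x] by linarith
      qed
      show "integrable \<mu> (\<lambda>x. (3 * cmod (f x))\<^sup>2)"
        using L2_integrable[OF f] by (simp add: power_mult_distrib)
    qed (use s(2) in auto)
  qed
qed (rule subset_L2)

end

section \<open>Fourier transforms of compactly supported measures\<close>

definition cexpo :: "complex \<Rightarrow> real \<Rightarrow> complex" where
  "cexpo z x = exp (2 * complex_of_real pi * \<i> * z * complex_of_real x)"

lemma cexpo_of_real: "cexpo (complex_of_real t) = expo t"
  by (simp add: cexpo_def expo_def fun_eq_iff mult.assoc)

lemma cexpo_mult_cnj_expo: "cexpo z x * cnj (expo t x) = cexpo (z - complex_of_real t) x"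
  unfolding cnj_expo by (simp add: cexpo_def expo_def exp_add[symmetric] algebra_simps)

lemma cnj_cexpo: "cnj (cexpo z x) = cexpo (- cnj z) x"
  by (simp add: cexpo_def exp_cnj)

lemma cmod_cexpo_le:
  assumes "\<bar>x\<bar> \<le> r"
  shows "cmod (cexpo z x) \<le> exp (2 * pi * cmod z * r)"
proof -
  have "cmod (cexpo z x) \<le> exp (cmod (2 * complex_of_real pi * \<i> * z * complex_of_real x))"
    unfolding cexpo_def by (rule norm_exp)
  also have "\<dots> = exp (2 * pi * cmod z * \<bar>x\<bar>)" by (simp add: norm_mult)
  also have "\<dots> \<le> exp (2 * pi * cmod z * r)" using assms by (simp add: mult_left_mono)
  finally show ?thesis .
qed

lemma entire_if_power_series:
  assumes sums: "\<And>z. (\<lambda>n. a n * z ^ n) sums f z"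
  shows "f holomorphic_on UNIV"
proof -
  have "f holomorphic_on ball 0 (real n)" for n
    by (rule power_series_holomorphic[where a = a]) (simp add: sums)
  then have "f holomorphic_on (\<Union>n::nat. ball 0 (real n))"
    by (intro holomorphic_on_UN_open) auto
  moreover have "(\<Union>n::nat. ball 0 (real n)) = (UNIV :: complex set)"
    using reals_Archimedean2 by auto
  ultimately show ?thesis by simp
qed

context compactly_supported_measure
begin

definition fourier :: "complex \<Rightarrow> complex" where
  "fourier z = (\<integral>x. cexpo z x \<partial>\<mu>)"

lemma cexpo_L2: "cexpo z \<in> L2 \<mu>"
  unfolding cexpo_def by (intro continuous_L2 continuous_intros)

lemma cnj_fourier: "cnj (fourier z) = fourier (- cnj z)"
  unfolding fourier_def cnj_cexpo[symmetric] by simp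

lemma fourier_of_real: "fourier (complex_of_real t) = L2_inner \<mu> (expo t) (\<lambda>_. 1)"
  by (simp add: fourier_def L2_inner_def cexpo_of_real)

lemma L2_normsq_cexpo_le: "L2_normsq \<mu> (cexpo z) \<le> (exp (2 * pi * cmod z * r))\<^sup>2 * measure \<mu> UNIV"
proof -
  have "L2_normsq \<mu> (cexpo z) \<le> (\<integral>x. (exp (2 * pi * cmod z * r))\<^sup>2 \<partial>\<mu>)"
    unfolding L2_normsq_def
  proof (rule integral_mono_AE)
    show "AE x in \<mu>. (cmod (cexpo z x))\<^sup>2 \<le> (exp (2 * pi * cmod z * r))\<^sup>2"
      using support by eventually_elim (intro power_mono cmod_cexpo_le norm_ge_zero)
  qed (use L2_integrable[OF cexpo_L2] in auto)
  then show ?thesis by (simp add: mult.commute)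
qed

lemma fourier_sums:
  "(\<lambda>n. ((2 * complex_of_real pi * \<i>) ^ n /\<^sub>R fact n * (\<integral>x. complex_of_real x ^ n \<partial>\<mu>)) * z ^ n)
     sums fourier z"
proof -
  define w where "w = 2 * complex_of_real pi * \<i> * z"
  define f where "f n x = (w * complex_of_real x) ^ n /\<^sub>R fact n" for n and x :: real
  have bound: "AE x in \<mu>. norm (f n x) \<le> (cmod w * \<bar>r\<bar>) ^ n /\<^sub>R fact n" for n
    using support
  proof eventually_elim
    case (elim x)
    have "(cmod w * \<bar>x\<bar>) ^ n \<le> (cmod w * \<bar>r\<bar>) ^ n"
      using elim by (intro power_mono mult_left_mono) auto
    then show ?case
      by (simp add: f_def norm_power norm_mult divide_right_mono divide_inverse_commute)
  qed
  have integrable_f: "integrable \<mu> (f n)" for n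
    by (rule integrable_const_bound[OF bound]) (simp add: f_def)
  have "(\<lambda>n. \<integral>x. f n x \<partial>\<mu>) sums (\<integral>x. (\<Sum>n. f n x) \<partial>\<mu>)"
  proof (rule sums_integral[OF integrable_f])
    show "AE x in \<mu>. summable (\<lambda>n. norm (f n x))"
      unfolding f_def by (intro AE_I2 summable_norm_exp)
    have "norm (\<integral>x. norm (f n x) \<partial>\<mu>) \<le> (cmod w * \<bar>r\<bar>) ^ n /\<^sub>R fact n * measure \<mu> UNIV" for n
    proof -
      have "(\<integral>x. norm (f n x) \<partial>\<mu>) \<le> (\<integral>x. (cmod w * \<bar>r\<bar>) ^ n /\<^sub>R fact n \<partial>\<mu>)"
        by (intro integral_mono_AE bound) (simp_all add: integrable_f)
      then show ?thesis by (simp add: mult_ac)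
    qed
    then show "summable (\<lambda>n. \<integral>x. norm (f n x) \<partial>\<mu>)"
      by (intro summable_comparison_test'[OF summable_mult2[OF summable_exp_generic]])
  qed
  moreover have "(\<Sum>n. f n x) = cexpo z x" for x
    by (simp add: f_def w_def cexpo_def exp_def)
  moreover have "(\<integral>x. f n x \<partial>\<mu>) = ((2 * complex_of_real pi * \<i>) ^ n /\<^sub>R fact n
      * (\<integral>x. complex_of_real x ^ n \<partial>\<mu>)) * z ^ n" for n
    by (simp add: f_def w_def power_mult_distrib scaleR_conv_of_real mult_ac)
  ultimately show ?thesis by (simp add: fourier_def)
qed

lemma fourier_entire: "fourier holomorphic_on UNIV"
  by (rule entire_if_power_series[OF fourier_sums])

lemma frame_elem_L2: "frame_elem R \<alpha> w \<in> L2 \<mu>"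
  unfolding frame_elem_def by (intro L2_scale expo_L2)

lemma L2_inner_cexpo_frame_elem:
  "L2_inner \<mu> (cexpo z) (frame_elem R \<alpha> w)
    = cnj (prod_list (map \<alpha> w)) * fourier (z - of_int (freq R w))"
proof -
  have "cexpo z x * cnj (frame_elem R \<alpha> w x)
      = cnj (prod_list (map \<alpha> w)) * cexpo (z - of_int (freq R w)) x" for x
    using cexpo_mult_cnj_expo[of z x "of_int (freq R w)"] by (simp add: frame_elem_def mult_ac)
  then show ?thesis by (simp add: L2_inner_def fourier_def)
qed

end

section \<open>Invariant measures of affine iterated function systems\<close>

definition max_abs :: "int set \<Rightarrow> real" where
  "max_abs S = real_of_int (Max (abs ` S))"

lemma abs_le_max_abs:
  assumes "finite S" "k \<in> S"
  shows "\<bar>real_of_int k\<bar> \<le> max_abs S"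
proof -
  have "\<bar>k\<bar> \<le> Max (abs ` S)" using assms by (intro Max_ge) auto
  then show ?thesis unfolding max_abs_def by linarith
qed

lemma tau_measurable [measurable]: "tau R b \<in> borel_measurable borel"
  unfolding tau_def by measurable

lemma expo_tau: "expo t (tau R b x) = expo (t / R) x * expo b (t / R)"
  by (simp add: tau_def expo_divide[of t] expo_add_arg expo_commute[of b])

locale ifs_measure =
  fixes R :: int and B :: "int set" and \<mu> :: "real measure"
  assumes abs_R_ge_2: "\<bar>R\<bar> \<ge> 2"
    and finite_B: "finite B" and zero_in_B: "0 \<in> B"
    and invariant_measure: "invariant_measure R B \<mu>"
begin

lemma abs_real_R_ge_2: "\<bar>real_of_int R\<bar> \<ge> 2"
  using abs_R_ge_2 by linarith

lemma R_nonzero: "real_of_int R \<noteq> 0"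
  using abs_R_ge_2 by auto

lemma card_B_pos: "card B > 0"
  using finite_B zero_in_B card_gt_0_iff by blast

lemma max_abs_B_nonneg: "0 \<le> max_abs B"
  using abs_le_max_abs[OF finite_B zero_in_B] by simp

sublocale prob_space \<mu>
  using invariant_measure by (simp add: invariant_measure_def)

lemma sets_mu: "sets \<mu> = sets borel"
  using invariant_measure by (simp add: invariant_measure_def)

lemma measure_mu:
  "E \<in> sets borel \<Longrightarrow> measure \<mu> E = (1 / card B) * (\<Sum>b\<in>B. measure \<mu> (tau R b -` E))"
  using invariant_measure by (simp add: invariant_measure_def)

lemma measure_tail_le_double:
  assumes s: "s \<ge> 0"
  shows "measure \<mu> {x. \<bar>x\<bar> > max_abs B + s} \<le> measure \<mu> {x. \<bar>x\<bar> > max_abs B + 2 * s}"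
proof -
  let ?E = "\<lambda>s. {x::real. \<bar>x\<bar> > max_abs B + s}"
  have E: "?E s \<in> sets borel" for s by measurable
  have "measure \<mu> (tau R b -` ?E s) \<le> measure \<mu> (?E (2 * s))" if b: "b \<in> B" for b
  proof (rule finite_measure_mono)
    show "tau R b -` ?E s \<subseteq> ?E (2 * s)"
    proof
      fix x assume "x \<in> tau R b -` ?E s"
      then have "max_abs B + s < \<bar>x + real_of_int b\<bar> / \<bar>real_of_int R\<bar>"
        by (simp add: tau_def abs_divide)
      then have "(max_abs B + s) * \<bar>real_of_int R\<bar> < \<bar>x + real_of_int b\<bar>"
        using R_nonzero by (simp add: pos_less_divide_eq)
      moreover have "(max_abs B + s) * 2 \<le> (max_abs B + s) * \<bar>real_of_int R\<bar>"
        using abs_real_R_ge_2 max_abs_B_nonneg s by (intro mult_left_mono) auto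
      ultimately show "x \<in> ?E (2 * s)" using abs_le_max_abs[OF finite_B b] by simp
    qed
  qed (simp add: sets_mu E)
  then have "(\<Sum>b\<in>B. measure \<mu> (tau R b -` ?E s)) \<le> card B * measure \<mu> (?E (2 * s))"
    by (rule sum_bounded_above)
  then have "(1 / card B) * (\<Sum>b\<in>B. measure \<mu> (tau R b -` ?E s)) \<le> measure \<mu> (?E (2 * s))"
    using card_B_pos by (simp add: field_simps)
  then show ?thesis by (simp only: measure_mu[OF E, of s])
qed

lemma measure_tail_eq_0:
  assumes s: "s > 0"
  shows "measure \<mu> {x. \<bar>x\<bar> > max_abs B + s} = 0"
proof -
  define E where "E n = {x::real. \<bar>x\<bar> > max_abs B + 2 ^ n * s}" for n :: nat
  have E_borel: "E n \<in> sets borel" for n unfolding E_def by measurable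
  have le: "measure \<mu> (E 0) \<le> measure \<mu> (E n)" for n
  proof (induction n)
    case (Suc n)
    also have "measure \<mu> (E n) \<le> measure \<mu> (E (Suc n))"
      using measure_tail_le_double[of "2 ^ n * s"] s by (simp add: E_def mult.assoc)
    finally show ?case .
  qed simp
  have "x \<notin> (\<Inter>n. E n)" for x
  proof -
    obtain n where "\<bar>x\<bar> / s < 2 ^ n" using real_arch_pow[of 2 "\<bar>x\<bar> / s"] by auto
    then have "\<bar>x\<bar> < 2 ^ n * s" using s by (simp add: field_simps)
    then have "x \<notin> E n" using max_abs_B_nonneg by (simp add: E_def)
    then show ?thesis by blast
  qed
  then have Inter: "(\<Inter>n. E n) = {}" by blast
  have "E (Suc n) \<subseteq> E n" for n
  proof -
    have "2 ^ n * s \<le> 2 ^ Suc n * s" using s by simp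
    then show ?thesis unfolding E_def by (intro Collect_mono impI) linarith
  qed
  then have "(\<lambda>n. measure \<mu> (E n)) \<longlonglongrightarrow> measure \<mu> (\<Inter>n. E n)"
    using E_borel by (intro finite_Lim_measure_decseq decseq_SucI) (auto simp: sets_mu)
  then have "(\<lambda>n. measure \<mu> (E n)) \<longlonglongrightarrow> 0" by (simp add: Inter)
  then have "measure \<mu> (E 0) \<le> 0" by (rule LIMSEQ_le_const) (use le in auto)
  then show ?thesis by (simp add: E_def measure_le_0_iff)
qed

sublocale compactly_supported_measure \<mu> "max_abs B + 1"
proof
  show "sets \<mu> = sets borel" by (rule sets_mu)
  have "{x::real. \<bar>x\<bar> > max_abs B + 1} \<in> null_sets \<mu>"
    using measure_tail_eq_0[of 1] by (simp add: null_sets_def emeasure_eq_measure sets_mu)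
  then show "AE x in \<mu>. \<bar>x\<bar> \<le> max_abs B + 1"
    by (rule AE_I') auto
qed

abbreviation digit_distr :: "int measure" where
  "digit_distr \<equiv> measure_pmf (pmf_of_set B)"

lemma set_pmf_digits [simp]: "set_pmf (pmf_of_set B) = B"
  using finite_B zero_in_B by (intro set_pmf_of_set) auto

lemma pmf_digits: "b \<in> B \<Longrightarrow> pmf (pmf_of_set B) b = 1 / card B"
  using finite_B by (subst pmf_of_set) auto

lemma digit_pair_sigma_finite: "pair_sigma_finite digit_distr \<mu>"
  using measure_pmf.sigma_finite_measure_axioms sigma_finite_measure_axioms
  by (rule pair_sigma_finite.intro)

lemma tau_pair_measurable [measurable]:
  "(\<lambda>(b, x). tau R b x) \<in> borel_measurable (digit_distr \<Otimes>\<^sub>M \<mu>)"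
  unfolding tau_def by measurable

lemma mu_eq_distr: "\<mu> = distr (digit_distr \<Otimes>\<^sub>M \<mu>) borel (\<lambda>(b, x). tau R b x)"
proof (rule measure_eqI)
  fix E assume "E \<in> sets \<mu>"
  then have E [measurable]: "E \<in> sets borel" by (simp add: sets_mu)
  let ?\<tau> = "\<lambda>(b, x). tau R b x"
  have preimage: "?\<tau> -` E \<in> sets (digit_distr \<Otimes>\<^sub>M \<mu>)"
    using measurable_sets[OF tau_pair_measurable E] by (simp add: space_pair_measure)
  have "Pair b -` (?\<tau> -` E) = tau R b -` E" for b by auto
  then have "emeasure (distr (digit_distr \<Otimes>\<^sub>M \<mu>) borel ?\<tau>) E
      = (\<integral>\<^sup>+b. emeasure \<mu> (tau R b -` E) \<partial>digit_distr)"
    using emeasure_pair_measure_alt[OF preimage]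
    by (simp add: emeasure_distr[OF tau_pair_measurable E] space_pair_measure)
  also have "\<dots> = (\<Sum>b\<in>B. ennreal (measure \<mu> (tau R b -` E))) / card B"
    using finite_B zero_in_B by (subst nn_integral_pmf_of_set) (auto simp: emeasure_eq_measure)
  also have "\<dots> = ennreal (measure \<mu> E)"
    using card_B_pos measure_mu[OF E]
    by (simp add: ennreal_of_nat_eq_real_of_nat divide_ennreal sum_nonneg)
  finally show "emeasure \<mu> E = emeasure (distr (digit_distr \<Otimes>\<^sub>M \<mu>) borel ?\<tau>) E"
    by (simp add: emeasure_eq_measure)
qed (simp add: sets_mu)

context
  fixes f :: "real \<Rightarrow> 'b::{banach, second_countable_topology}"
  assumes f: "integrable \<mu> f"
begin

lemma integrand_measurable: "f \<in> borel_measurable borel"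
  using borel_measurable_integrable[OF f] by (simp add: borel_measurable_eq)

lemma integrable_tau_pair: "integrable (digit_distr \<Otimes>\<^sub>M \<mu>) (\<lambda>(b, x). f (tau R b x))"
proof -
  note [measurable] = integrand_measurable
  have "integrable (distr (digit_distr \<Otimes>\<^sub>M \<mu>) borel (\<lambda>(b, x). tau R b x)) f"
    using f by (simp flip: mu_eq_distr)
  then show ?thesis by (simp add: integrable_distr_eq split_beta')
qed

lemma integrable_tau:
  assumes b: "b \<in> B"
  shows "integrable \<mu> (\<lambda>x. f (tau R b x))"
  using pair_sigma_finite.AE_integrable_fst'[OF digit_pair_sigma_finite integrable_tau_pair] b
  by (simp add: AE_measure_pmf_iff)

lemma integral_mu: "(\<integral>x. f x \<partial>\<mu>) = (1 / card B) *\<^sub>R (\<Sum>b\<in>B. \<integral>x. f (tau R b x) \<partial>\<mu>)"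
proof -
  note [measurable] = integrand_measurable
  have "(\<integral>x. f x \<partial>\<mu>)
      = (\<integral>x. f x \<partial>distr (digit_distr \<Otimes>\<^sub>M \<mu>) borel (\<lambda>(b, x). tau R b x))"
    by (simp flip: mu_eq_distr)
  also have "\<dots> = (\<integral>(b, x). f (tau R b x) \<partial>(digit_distr \<Otimes>\<^sub>M \<mu>))"
    by (simp add: integral_distr split_beta')
  also have "\<dots> = (\<integral>b. (\<integral>x. f (tau R b x) \<partial>\<mu>) \<partial>digit_distr)"
    using pair_sigma_finite.integral_fst'[OF digit_pair_sigma_finite integrable_tau_pair] by simp
  also have "\<dots> = (1 / card B) *\<^sub>R (\<Sum>b\<in>B. \<integral>x. f (tau R b x) \<partial>\<mu>)"
    using finite_B by (subst integral_measure_pmf[of B]) (simp_all add: scaleR_sum_right pmf_digits)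
  finally show ?thesis .
qed

end

lemma L2_tau:
  assumes f: "f \<in> L2 \<mu>" and b: "b \<in> B"
  shows "(\<lambda>x. f (tau R b x)) \<in> L2 \<mu>"
proof -
  have [measurable]: "f \<in> borel_measurable borel"
    using L2_measurable[OF f] by (simp add: borel_measurable_eq)
  show ?thesis
    using integrable_tau[OF L2_integrable[OF f] b] by (simp add: L2_def)
qed

lemma fourier_refinement:
  "fourier (of_real t) = mB B (t / R) * fourier (of_real (t / R))"
proof -
  have "integrable \<mu> (expo t)"
    using L2_inner_integrable[OF expo_L2 one_L2, of t] by simp
  then have "fourier (of_real t) = (1 / card B) *\<^sub>R (\<Sum>b\<in>B. \<integral>x. expo t (tau R b x) \<partial>\<mu>)"
    unfolding fourier_def cexpo_of_real by (rule integral_mu)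
  also have "\<dots> = (1 / card B) *\<^sub>R (\<Sum>b\<in>B. fourier (of_real (t / R)) * expo b (t / R))"
    unfolding expo_tau fourier_def cexpo_of_real by simp
  finally show ?thesis
    by (simp add: mB_def scaleR_conv_of_real sum_distrib_left mult_ac)
qed

end

section \<open>Sums over words\<close>

lemma nonneg_has_sum_exhaustion:
  fixes F :: "'a \<Rightarrow> real"
  assumes nonneg: "\<And>x. 0 \<le> F x"
    and A: "incseq A" "\<And>n. finite (A n)" "(\<Union>n. A n) = I"
    and lim: "(\<lambda>n. sum F (A n)) \<longlonglongrightarrow> s"
  shows "(F has_sum s) I"
proof -
  have mono: "incseq (\<lambda>n. sum F (A n))"
    using A nonneg by (intro monoI sum_mono2) (auto simp: incseq_def)
  have le: "sum F (A n) \<le> s" for n by (rule incseq_le[OF mono lim])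
  show ?thesis
    unfolding has_sum_def
  proof (rule order_tendstoI)
    fix c assume "c < s"
    then obtain n where n: "c < sum F (A n)"
      using order_tendstoD(1)[OF lim] eventually_happens'[OF sequentially_bot] by blast
    show "\<forall>\<^sub>F X in finite_subsets_at_top I. c < sum F X"
      unfolding eventually_finite_subsets_at_top
    proof (intro exI conjI allI impI)
      fix X assume "finite X \<and> A n \<subseteq> X \<and> X \<subseteq> I"
      then have "sum F (A n) \<le> sum F X" using nonneg by (intro sum_mono2) auto
      with n show "c < sum F X" by simp
    qed (use A in auto)
  next
    fix c assume c: "s < c"
    show "\<forall>\<^sub>F X in finite_subsets_at_top I. sum F X < c"
    proof (rule eventually_finite_subsets_at_top_weakI)
      fix X assume X: "finite X" "X \<subseteq> I"
      have "\<forall>\<^sub>F n in sequentially. x \<in> A n" if "x \<in> X" for x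
        using that X(2) A(1,3) unfolding eventually_sequentially incseq_def by blast
      then have "\<forall>\<^sub>F n in sequentially. \<forall>x\<in>X. x \<in> A n"
        using X(1) by (intro eventually_ball_finite) auto
      then obtain n where "X \<subseteq> A n"
        using eventually_happens'[OF sequentially_bot] by blast
      then have "sum F X \<le> sum F (A n)" using A nonneg by (intro sum_mono2) auto
      with le[of n] c show "sum F X < c" by simp
    qed
  qed
qed

definition words :: "int set \<Rightarrow> nat \<Rightarrow> int list set" where
  "words L n = {w. set w \<subseteq> L \<and> length w = n}"

definition Omega_upto :: "int set \<Rightarrow> nat \<Rightarrow> int list set" where
  "Omega_upto L n = {w \<in> Omega L. length w \<le> n}"

lemma finite_words: "finite L \<Longrightarrow> finite (words L n)"
  unfolding words_def by (rule finite_lists_length_eq)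

lemma finite_Omega_upto: "finite L \<Longrightarrow> finite (Omega_upto L n)"
  by (rule finite_subset[OF _ finite_lists_length_le]) (auto simp: Omega_upto_def Omega_def)

lemma incseq_Omega_upto: "incseq (Omega_upto L)"
  by (auto simp: incseq_def Omega_upto_def)

lemma Union_Omega_upto: "(\<Union>n. Omega_upto L n) = Omega L"
  by (auto simp: Omega_upto_def)

lemma words_0: "words L 0 = {[]}"
  by (auto simp: words_def)

lemma sum_words_Suc: "(\<Sum>w\<in>words L (Suc n). F w) = (\<Sum>l\<in>L. \<Sum>w\<in>words L n. F (l # w))"
proof -
  have "words L (Suc n) = (\<lambda>(l, w). l # w) ` (L \<times> words L n)"
    by (auto simp: words_def length_Suc_conv image_iff)
  then have "(\<Sum>w\<in>words L (Suc n). F w) = (\<Sum>(l, w)\<in>L \<times> words L n. F (l # w))"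
    by (simp add: sum.reindex inj_on_def split_beta')
  then show ?thesis by (simp add: sum.cartesian_product)
qed

lemma words_Suc_eq_snoc:
  assumes "0 \<in> L"
  shows "words L (Suc n) = {w \<in> words L (Suc n). last w \<noteq> 0} \<union> (\<lambda>w. w @ [0]) ` words L n"
proof (intro equalityI subsetI)
  fix w assume w: "w \<in> words L (Suc n)"
  then have "w = butlast w @ [last w]" by (cases w) (auto simp: words_def)
  moreover have "butlast w \<in> words L n"
    using w by (auto simp: words_def dest: in_set_butlastD)
  ultimately show "w \<in> {w \<in> words L (Suc n). last w \<noteq> 0} \<union> (\<lambda>w. w @ [0]) ` words L n"
    using w by (cases "last w = 0") auto
qed (use assms in \<open>auto simp: words_def\<close>)

lemma sum_words_eq_sum_Omega_upto:
  assumes L: "finite L" "0 \<in> L" and snoc_0: "\<And>w. F (w @ [0]) = F w"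
  shows "(\<Sum>w\<in>words L n. F w) = (\<Sum>w\<in>Omega_upto L n. F w)"
proof (induction n)
  case 0
  have "Omega_upto L 0 = {[]}" by (auto simp: Omega_upto_def Omega_def)
  then show ?case by (simp add: words_0)
next
  case (Suc n)
  let ?W = "{w \<in> words L (Suc n). last w \<noteq> 0}"
  have "(\<Sum>w\<in>words L (Suc n). F w) = (\<Sum>w\<in>?W. F w) + (\<Sum>w\<in>(\<lambda>w. w @ [0]) ` words L n. F w)"
    by (subst words_Suc_eq_snoc[OF L(2)], rule sum.union_disjoint)
      (auto simp: finite_words[OF L(1)])
  also have "(\<Sum>w\<in>(\<lambda>w. w @ [0]) ` words L n. F w) = (\<Sum>w\<in>words L n. F w)"
    by (subst sum.reindex) (auto simp: inj_on_def snoc_0)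
  also have "(\<Sum>w\<in>?W. F w) + \<dots> = (\<Sum>w\<in>?W \<union> Omega_upto L n. F w)"
    unfolding Suc using finite_words[OF L(1)]
    by (intro sum.union_disjoint[symmetric] finite_Omega_upto[OF L(1)])
      (simp, auto simp: words_def Omega_upto_def)
  also have "?W \<union> Omega_upto L n = Omega_upto L (Suc n)"
    by (auto simp: words_def Omega_upto_def Omega_def le_Suc_eq)
  finally show ?case .
qed

section \<open>The Bessel inequality\<close>

lemma sum_cmod_orthogonal_columns:
  fixes u :: "'i \<Rightarrow> 'j \<Rightarrow> complex"
  assumes B: "finite B"
    and orth: "\<And>b b'. b \<in> B \<Longrightarrow> b' \<in> B \<Longrightarrow>
      (\<Sum>l\<in>L. u l b * cnj (u l b')) = (if b = b' then of_real c else 0)"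
  shows "(\<Sum>l\<in>L. (cmod (\<Sum>b\<in>B. cnj (u l b) * a b))\<^sup>2) = c * (\<Sum>b\<in>B. (cmod (a b))\<^sup>2)"
proof -
  have "complex_of_real (\<Sum>l\<in>L. (cmod (\<Sum>b\<in>B. cnj (u l b) * a b))\<^sup>2)
      = (\<Sum>l\<in>L. (\<Sum>b\<in>B. cnj (u l b) * a b) * (\<Sum>b\<in>B. u l b * cnj (a b)))"
    by (simp add: complex_norm_square del: of_real_power)
  also have "\<dots> = (\<Sum>l\<in>L. \<Sum>b\<in>B. \<Sum>b'\<in>B. (a b * cnj (a b')) * (u l b' * cnj (u l b)))"
    unfolding sum_product by (intro sum.cong refl) (simp only: mult_ac)
  also have "\<dots> = (\<Sum>b\<in>B. \<Sum>b'\<in>B. (a b * cnj (a b')) * (\<Sum>l\<in>L. u l b' * cnj (u l b)))"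
    unfolding sum_distrib_left by (subst sum.swap) (intro sum.cong refl sum.swap)
  also have "\<dots> = (\<Sum>b\<in>B. \<Sum>b'\<in>B. if b' = b then (a b * cnj (a b)) * of_real c else 0)"
    by (intro sum.cong refl) (simp add: orth)
  also have "\<dots> = (\<Sum>b\<in>B. (a b * cnj (a b)) * of_real c)"
    using B by simp
  also have "\<dots> = complex_of_real (c * (\<Sum>b\<in>B. (cmod (a b))\<^sup>2))"
    by (simp add: complex_norm_square sum_distrib_left mult.commute del: of_real_power)
  finally show ?thesis by (simp only: of_real_eq_iff)
qed

lemma frame_elem_Nil: "frame_elem R \<alpha> [] = (\<lambda>_. 1)"
  by (simp add: frame_elem_def fun_eq_iff)

lemma freq_snoc_0: "freq R (w @ [0]) = freq R w"
  by (induction w) auto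

lemma expo_tau_gl:
  "cnj (expo l (tau R b x)) * expo t (tau R b x) = expo b (gl R l t) * expo (gl R l t) x"
proof -
  have "cnj (expo l (tau R b x)) * expo t (tau R b x) = expo (t - l) (tau R b x)"
    by (simp add: cnj_expo expo_add[symmetric])
  also have "\<dots> = expo b (gl R l t) * expo (gl R l t) x"
    by (simp add: expo_tau gl_def mult.commute)
  finally show ?thesis .
qed

locale ifs_frame = ifs_measure R B \<mu>
  for R :: int and B :: "int set" and \<mu> :: "real measure" +
  fixes L :: "int set" and \<alpha> :: "int \<Rightarrow> complex"
  assumes finite_L: "finite L" and zero_in_L: "0 \<in> L"
    and alpha_0: "\<alpha> 0 = 1"
    and orthonormal_columns: "\<forall>b\<in>B. \<forall>b'\<in>B.
       (\<Sum>l\<in>L. (1 / of_nat (card B)) *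
          (expo (real_of_int l * real_of_int b / real_of_int R) 1 * \<alpha> l) *
          cnj (expo (real_of_int l * real_of_int b' / real_of_int R) 1 * \<alpha> l))
       = (if b = b' then 1 else 0)"
begin

definition cuntz_adjoint :: "int \<Rightarrow> (real \<Rightarrow> complex) \<Rightarrow> real \<Rightarrow> complex" where
  "cuntz_adjoint l f x
    = (1 / of_nat (card B)) * (\<Sum>b\<in>B. cnj (\<alpha> l * expo l (tau R b x)) * f (tau R b x))"

lemma sum_cmod_cuntz_adjoint:
  "(\<Sum>l\<in>L. (cmod (cuntz_adjoint l f x))\<^sup>2) = (1 / card B) * (\<Sum>b\<in>B. (cmod (f (tau R b x)))\<^sup>2)"
proof -
  define u where "u l b = expo (real_of_int l * real_of_int b / R) 1 * \<alpha> l" for l b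
  have orth: "(\<Sum>l\<in>L. u l b * cnj (u l b')) = (if b = b' then of_real (card B) else 0)"
    if "b \<in> B" "b' \<in> B" for b b'
  proof -
    have "(1 / of_nat (card B)) * (\<Sum>l\<in>L. u l b * cnj (u l b')) = (if b = b' then 1 else 0)"
      using orthonormal_columns that unfolding u_def sum_distrib_left mult.assoc by blast
    then show ?thesis using card_B_pos by (auto simp: divide_eq_eq)
  qed
  have "cuntz_adjoint l f x
      = (1 / of_nat (card B)) * (cnj (expo (l / R) x) * (\<Sum>b\<in>B. cnj (u l b) * f (tau R b x)))" for l
  proof -
    have "expo l (tau R b x) = expo (l / R) x * expo (l * b / R) 1" for b
      by (simp add: expo_tau) (simp add: expo_def mult_ac)
    then show ?thesis unfolding cuntz_adjoint_def u_def sum_distrib_left by (simp add: mult_ac)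
  qed
  then have "(\<Sum>l\<in>L. (cmod (cuntz_adjoint l f x))\<^sup>2)
      = (1 / card B)\<^sup>2 * (\<Sum>l\<in>L. (cmod (\<Sum>b\<in>B. cnj (u l b) * f (tau R b x)))\<^sup>2)"
    by (simp add: norm_mult norm_divide power_mult_distrib power_divide flip: sum_divide_distrib)
  also have "\<dots> = (1 / card B)\<^sup>2 * (card B * (\<Sum>b\<in>B. (cmod (f (tau R b x)))\<^sup>2))"
    by (simp only: sum_cmod_orthogonal_columns[OF finite_B orth])
  finally show ?thesis using card_B_pos by (simp add: power2_eq_square)
qed

lemma cuntz_adjoint_L2:
  assumes f: "f \<in> L2 \<mu>"
  shows "cuntz_adjoint l f \<in> L2 \<mu>"
proof -
  have [measurable]: "f \<in> borel_measurable \<mu>" using f by (rule L2_measurable)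
  have "(\<lambda>x. cnj (\<alpha> l * expo l x) * f x) \<in> L2 \<mu>"
    using L2_integrable[OF L2_scale[OF f, of "\<alpha> l"]] by (simp add: L2_def norm_mult)
  then have "(\<lambda>x. cnj (\<alpha> l * expo l (tau R b x)) * f (tau R b x)) \<in> L2 \<mu>" if "b \<in> B" for b
    using that by (rule L2_tau)
  then show ?thesis
    unfolding cuntz_adjoint_def[abs_def] by (intro L2_scale L2_sum)
qed

lemma sum_normsq_cuntz_adjoint:
  assumes f: "f \<in> L2 \<mu>"
  shows "(\<Sum>l\<in>L. L2_normsq \<mu> (cuntz_adjoint l f)) = L2_normsq \<mu> f"
proof -
  have "(\<Sum>l\<in>L. L2_normsq \<mu> (cuntz_adjoint l f))
      = (\<integral>x. (\<Sum>l\<in>L. (cmod (cuntz_adjoint l f x))\<^sup>2) \<partial>\<mu>)"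
    unfolding L2_normsq_def
    by (intro Bochner_Integration.integral_sum[symmetric] L2_integrable cuntz_adjoint_L2 f)
  also have "\<dots> = (1 / card B) * (\<Sum>b\<in>B. \<integral>x. (cmod (f (tau R b x)))\<^sup>2 \<partial>\<mu>)"
    unfolding sum_cmod_cuntz_adjoint using integrable_tau[OF L2_integrable[OF f]] by simp
  also have "\<dots> = L2_normsq \<mu> f"
    unfolding L2_normsq_def using integral_mu[OF L2_integrable[OF f]] by simp
  finally show ?thesis .
qed

lemma cuntz_adjoint_expo:
  "cuntz_adjoint l (expo t) = (\<lambda>x. (cnj (\<alpha> l) * mB B (gl R l t)) * expo (gl R l t) x)"
proof
  fix x
  have "cuntz_adjoint l (expo t) x
      = (1 / of_nat (card B)) * (\<Sum>b\<in>B. cnj (\<alpha> l) * (expo b (gl R l t) * expo (gl R l t) x))"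
    unfolding cuntz_adjoint_def expo_tau_gl[symmetric] by (simp add: mult_ac)
  then show "cuntz_adjoint l (expo t) x = (cnj (\<alpha> l) * mB B (gl R l t)) * expo (gl R l t) x"
    by (simp add: mB_def sum_distrib_left sum_distrib_right mult_ac)
qed

lemma frame_elem_Cons_tau:
  "frame_elem R \<alpha> (l # w) (tau R b x) = \<alpha> l * expo l (tau R b x) * frame_elem R \<alpha> w x"
proof -
  have "expo (R * freq R w) (tau R b x) = expo (freq R w) (x + real_of_int b)"
    using R_nonzero by (simp add: expo_def tau_def)
  also have "\<dots> = expo (freq R w) x"
    by (simp add: expo_add_arg expo_of_int)
  finally show ?thesis by (simp add: frame_elem_def expo_add)
qed

lemma L2_inner_frame_elem_Cons:
  assumes f: "f \<in> L2 \<mu>"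
  shows "L2_inner \<mu> f (frame_elem R \<alpha> (l # w)) = L2_inner \<mu> (cuntz_adjoint l f) (frame_elem R \<alpha> w)"
proof -
  let ?g = "\<lambda>x. f x * cnj (frame_elem R \<alpha> (l # w) x)"
  have int: "integrable \<mu> ?g"
    by (rule L2_inner_integrable[OF f frame_elem_L2])
  have "L2_inner \<mu> f (frame_elem R \<alpha> (l # w)) = (1 / card B) *\<^sub>R (\<Sum>b\<in>B. \<integral>x. ?g (tau R b x) \<partial>\<mu>)"
    unfolding L2_inner_def by (rule integral_mu[OF int])
  also have "\<dots> = (\<integral>x. (1 / of_nat (card B)) * (\<Sum>b\<in>B. ?g (tau R b x)) \<partial>\<mu>)"
    using integrable_tau[OF int] by (simp add: scaleR_conv_of_real)
  also have "\<dots> = L2_inner \<mu> (cuntz_adjoint l f) (frame_elem R \<alpha> w)"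
    unfolding L2_inner_def cuntz_adjoint_def frame_elem_Cons_tau
    by (intro Bochner_Integration.integral_cong refl)
      (simp add: sum_distrib_left sum_distrib_right mult_ac)
  finally show ?thesis .
qed

definition frame_energy :: "nat \<Rightarrow> (real \<Rightarrow> complex) \<Rightarrow> real" where
  "frame_energy n f = (\<Sum>w\<in>words L n. (cmod (L2_inner \<mu> f (frame_elem R \<alpha> w)))\<^sup>2)"

definition frame_defect :: "nat \<Rightarrow> (real \<Rightarrow> complex) \<Rightarrow> real" where
  "frame_defect n f = L2_normsq \<mu> f - frame_energy n f"

lemma frame_energy_0: "frame_energy 0 f = (cmod (L2_inner \<mu> f (\<lambda>_. 1)))\<^sup>2"
  by (simp add: frame_energy_def words_0 frame_elem_Nil)

lemma frame_energy_Suc: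
  "f \<in> L2 \<mu> \<Longrightarrow> frame_energy (Suc n) f = (\<Sum>l\<in>L. frame_energy n (cuntz_adjoint l f))"
  by (simp add: frame_energy_def sum_words_Suc L2_inner_frame_elem_Cons)

lemma frame_energy_nonneg: "0 \<le> frame_energy n f"
  by (simp add: frame_energy_def sum_nonneg)

lemma frame_energy_scale: "frame_energy n (\<lambda>x. c * f x) = (cmod c)\<^sup>2 * frame_energy n f"
  by (simp add: frame_energy_def L2_inner_scale_left norm_mult power_mult_distrib sum_distrib_left)

lemma frame_energy_parallelogram:
  assumes "f \<in> L2 \<mu>" "g \<in> L2 \<mu>"
  shows "frame_energy n (\<lambda>x. f x + g x) + frame_energy n (\<lambda>x. f x - g x)
    = 2 * frame_energy n f + 2 * frame_energy n g"
  unfolding frame_energy_def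
  by (simp add: L2_inner_add_left L2_inner_diff_left assms frame_elem_L2 sum.distrib[symmetric]
      cmod_parallelogram sum_distrib_left)

lemma frame_elem_snoc_0: "frame_elem R \<alpha> (w @ [0]) = frame_elem R \<alpha> w"
  by (simp add: frame_elem_def freq_snoc_0 alpha_0 fun_eq_iff)

lemma frame_energy_eq_sum_Omega_upto:
  "frame_energy n f = (\<Sum>w\<in>Omega_upto L n. (cmod (L2_inner \<mu> f (frame_elem R \<alpha> w)))\<^sup>2)"
  unfolding frame_energy_def
  by (intro sum_words_eq_sum_Omega_upto finite_L zero_in_L) (simp add: frame_elem_snoc_0)

lemma incseq_frame_energy: "incseq (\<lambda>n. frame_energy n f)"
  unfolding frame_energy_eq_sum_Omega_upto
  by (intro monoI sum_mono2 finite_Omega_upto finite_L monoD[OF incseq_Omega_upto]) auto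

lemma frame_defect_nonneg: "f \<in> L2 \<mu> \<Longrightarrow> 0 \<le> frame_defect n f"
proof (induction n arbitrary: f)
  case 0
  then show ?case
    using L2_inner_one_le[OF prob_space_axioms] by (simp add: frame_defect_def frame_energy_0)
next
  case (Suc n)
  have "frame_defect (Suc n) f = (\<Sum>l\<in>L. frame_defect n (cuntz_adjoint l f))"
    using Suc.prems
    by (simp add: frame_defect_def frame_energy_Suc sum_subtractf sum_normsq_cuntz_adjoint)
  then show ?case using Suc by (simp add: cuntz_adjoint_L2 sum_nonneg)
qed

lemma frame_energy_le_normsq: "f \<in> L2 \<mu> \<Longrightarrow> frame_energy n f \<le> L2_normsq \<mu> f"
  using frame_defect_nonneg[of f n] by (simp add: frame_defect_def)

lemma frame_defect_le_normsq: "frame_defect n f \<le> L2_normsq \<mu> f"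
  using frame_energy_nonneg[of n f] by (simp add: frame_defect_def)

lemma frame_defect_scale: "frame_defect n (\<lambda>x. c * f x) = (cmod c)\<^sup>2 * frame_defect n f"
  by (simp add: frame_defect_def L2_normsq_scale frame_energy_scale right_diff_distrib)

lemma frame_defect_add_le:
  assumes "f \<in> L2 \<mu>" "g \<in> L2 \<mu>"
  shows "frame_defect n (\<lambda>x. f x + g x) \<le> 2 * frame_defect n f + 2 * frame_defect n g"
proof -
  have "frame_defect n (\<lambda>x. f x + g x) + frame_defect n (\<lambda>x. f x - g x)
      = 2 * frame_defect n f + 2 * frame_defect n g"
    using L2_normsq_parallelogram[OF assms] frame_energy_parallelogram[OF assms, of n]
    by (simp add: frame_defect_def)
  then show ?thesis using frame_defect_nonneg[OF L2_diff[OF assms], of n] by linarith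
qed

definition parseval_functions :: "(real \<Rightarrow> complex) set" where
  "parseval_functions = {f \<in> L2 \<mu>. (\<lambda>n. frame_defect n f) \<longlonglongrightarrow> 0}"

lemma has_sum_parseval_function:
  assumes "f \<in> parseval_functions"
  shows "((\<lambda>w. (cmod (L2_inner \<mu> f (frame_elem R \<alpha> w)))\<^sup>2) has_sum L2_normsq \<mu> f) (Omega L)"
proof (rule nonneg_has_sum_exhaustion)
  have "(\<lambda>n. L2_normsq \<mu> f - frame_defect n f) \<longlonglongrightarrow> L2_normsq \<mu> f - 0"
    using assms by (intro tendsto_intros) (simp add: parseval_functions_def)
  then show "(\<lambda>n. \<Sum>w\<in>Omega_upto L n. (cmod (L2_inner \<mu> f (frame_elem R \<alpha> w)))\<^sup>2)
      \<longlonglongrightarrow> L2_normsq \<mu> f"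
    by (simp add: frame_defect_def frame_energy_eq_sum_Omega_upto)
qed (simp_all add: incseq_Omega_upto finite_Omega_upto finite_L Union_Omega_upto)

lemma parseval_functions_add:
  assumes f: "f \<in> parseval_functions" and g: "g \<in> parseval_functions"
  shows "(\<lambda>x. f x + g x) \<in> parseval_functions"
proof -
  have L2: "f \<in> L2 \<mu>" "g \<in> L2 \<mu>" using f g by (simp_all add: parseval_functions_def)
  have "(\<lambda>n. 2 * frame_defect n f + 2 * frame_defect n g) \<longlonglongrightarrow> 2 * 0 + 2 * 0"
    using f g by (intro tendsto_intros) (simp_all add: parseval_functions_def)
  then have bound: "(\<lambda>n. 2 * frame_defect n f + 2 * frame_defect n g) \<longlonglongrightarrow> 0" by simp
  have "(\<lambda>n. frame_defect n (\<lambda>x. f x + g x)) \<longlonglongrightarrow> 0"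
    by (rule tendsto_sandwich[OF _ _ tendsto_const bound])
      (simp_all add: frame_defect_nonneg frame_defect_add_le L2 L2_add)
  then show ?thesis by (simp add: parseval_functions_def L2 L2_add)
qed

lemma parseval_functions_limit:
  assumes f: "f \<in> L2 \<mu>" and s: "\<And>m::nat. s m \<in> parseval_functions"
    and lim: "(\<lambda>m. L2_normsq \<mu> (\<lambda>x. f x - s m x)) \<longlonglongrightarrow> 0"
  shows "f \<in> parseval_functions"
proof -
  have sL2: "s m \<in> L2 \<mu>" for m using s by (simp add: parseval_functions_def)
  have "\<forall>\<^sub>F n in sequentially. frame_defect n f < e" if e: "e > 0" for e
  proof -
    have "\<forall>\<^sub>F m in sequentially. L2_normsq \<mu> (\<lambda>x. f x - s m x) < e / 4"
      using order_tendstoD(2)[OF lim, of "e / 4"] e by simp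
    then obtain m where m: "L2_normsq \<mu> (\<lambda>x. f x - s m x) < e / 4"
      using eventually_happens'[OF sequentially_bot] by blast
    have "\<forall>\<^sub>F n in sequentially. frame_defect n (s m) < e / 4"
      using s[of m] e by (intro order_tendstoD(2)[of _ 0]) (simp_all add: parseval_functions_def)
    then show ?thesis
    proof eventually_elim
      case (elim n)
      have "frame_defect n f \<le> 2 * frame_defect n (\<lambda>x. f x - s m x) + 2 * frame_defect n (s m)"
        using frame_defect_add_le[OF L2_diff[OF f sL2] sL2, of n m m] by simp
      also have "\<dots> < e"
        using elim m frame_defect_le_normsq[of n "\<lambda>x. f x - s m x"] by linarith
      finally show ?case .
    qed
  qed
  then have "(\<lambda>n. frame_defect n f) \<longlonglongrightarrow> 0"
    using frame_defect_nonneg[OF f]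
    by (intro order_tendstoI) (auto intro!: always_eventually intro: less_le_trans)
  then show ?thesis using f by (simp add: parseval_functions_def)
qed

lemma closed_L2_subspace_parseval_functions: "closed_L2_subspace \<mu> parseval_functions"
proof
  show "parseval_functions \<subseteq> L2 \<mu>" by (auto simp: parseval_functions_def)
  show "(\<lambda>x. c * f x) \<in> parseval_functions" if "f \<in> parseval_functions" for f c
    using that
    by (auto simp: parseval_functions_def L2_scale frame_defect_scale
        intro!: tendsto_mult_right_zero)
qed (fact parseval_functions_add parseval_functions_limit)+

end

section \<open>Fixed points of the transfer operator\<close>

lemma finite_invariant_set_contains_minimal:
  assumes "finite M" "M \<noteq> {}" "invariant_set R B L \<alpha> M"
  shows "\<exists>M'\<subseteq>M. finite_minimal_invariant R B L \<alpha> M'"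
  using assms
proof (induction rule: finite_psubset_induct)
  case (psubset M)
  show ?case
  proof (cases "\<exists>M'. M' \<subset> M \<and> M' \<noteq> {} \<and> invariant_set R B L \<alpha> M'")
    case True
    then obtain M' where M': "M' \<subset> M" "M' \<noteq> {}" "invariant_set R B L \<alpha> M'" by blast
    from psubset.IH[OF this] M'(1) show ?thesis by blast
  next
    case False
    then have "finite_minimal_invariant R B L \<alpha> M"
      using psubset by (auto simp: finite_minimal_invariant_def)
    then show ?thesis by blast
  qed
qed

lemma holomorphic_eq_const_if_infinite_level_set:
  assumes h: "h holomorphic_on S" and S: "open S" "connected S" and K: "compact K" "K \<subseteq> S"
    and infinite: "infinite {z \<in> K. h z = c}" and z: "z \<in> S"
  shows "h z = c"
proof -
  have "(\<lambda>z. h z - c) holomorphic_on S" by (intro holomorphic_intros h)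
  then have "(\<lambda>z. h z - c) constant_on S"
    using holomorphic_compact_finite_zeros[of "\<lambda>z. h z - c" S K] S K infinite by auto
  then obtain d where d: "\<And>z. z \<in> S \<Longrightarrow> h z - c = d" by (auto simp: constant_on_def)
  obtain w where "w \<in> K" "h w = c" using infinite not_finite_existsD by blast
  then have "d = 0" using d[of w] K(2) by auto
  then show ?thesis using d[OF z] by simp
qed

lemma inj_divide_power:
  fixes c r :: real
  assumes c: "c \<noteq> 0" and r: "\<bar>r\<bar> > 1"
  shows "inj (\<lambda>n. c / r ^ n)"
proof (rule injI)
  fix m n assume "c / r ^ m = c / r ^ n"
  then have "r ^ m = r ^ n" using c r by (auto simp: field_simps)
  then have "\<bar>r\<bar> ^ m = \<bar>r\<bar> ^ n" by (metis power_abs)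
  then show "m = n" using r by simp
qed

context ifs_frame
begin

definition weight :: "int \<Rightarrow> real \<Rightarrow> real" where
  "weight l t = (cmod (\<alpha> l))\<^sup>2 * (cmod (mB B (gl R l t)))\<^sup>2"

definition transfer :: "(real \<Rightarrow> real) \<Rightarrow> real \<Rightarrow> real" where
  "transfer u t = (\<Sum>l\<in>L. weight l t * u (gl R l t))"

lemma weight_nonneg: "0 \<le> weight l t"
  by (simp add: weight_def)

lemma weight_eq_0_iff: "weight l t = 0 \<longleftrightarrow> \<alpha> l * mB B (gl R l t) = 0"
  by (simp add: weight_def)

lemma L2_normsq_expo: "L2_normsq \<mu> (expo t) = 1"
  using prob_space by (simp add: L2_normsq_def)

lemma sum_weight: "(\<Sum>l\<in>L. weight l t) = 1"
  using sum_normsq_cuntz_adjoint[OF expo_L2, of t]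
  by (simp add: cuntz_adjoint_expo L2_normsq_scale L2_normsq_expo weight_def norm_mult
      power_mult_distrib)

lemma gl_in_symmetric_interval:
  assumes "\<bar>real_of_int l\<bar> \<le> A" "t \<in> {-A..A}"
  shows "gl R l t \<in> {-A..A}"
proof -
  have "\<bar>t - real_of_int l\<bar> \<le> 2 * A" using assms by auto
  also have "\<dots> \<le> \<bar>real_of_int R\<bar> * A"
    using abs_real_R_ge_2 assms(1) by (intro mult_right_mono) auto
  finally have "\<bar>gl R l t\<bar> \<le> A"
    using R_nonzero by (simp add: gl_def abs_divide divide_le_eq mult.commute)
  then show ?thesis by auto
qed

lemma minimum_set_invariant:
  assumes fixed: "transfer u = u" and stable: "\<And>l t. l \<in> L \<Longrightarrow> t \<in> K \<Longrightarrow> gl R l t \<in> K"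
    and lower: "\<And>t. t \<in> K \<Longrightarrow> m \<le> u t"
  shows "invariant_set R B L \<alpha> {t \<in> K. u t = m}"
  unfolding invariant_set_def
proof (intro ballI impI)
  fix t l assume t: "t \<in> {t \<in> K. u t = m}" and l: "l \<in> L" and nz: "\<alpha> l * mB B (gl R l t) \<noteq> 0"
  have "(\<Sum>k\<in>L. weight k t * (u (gl R k t) - m)) = transfer u t - (\<Sum>k\<in>L. weight k t) * m"
    by (simp add: transfer_def right_diff_distrib sum_subtractf sum_distrib_right)
  also have "\<dots> = 0" using t by (simp add: fixed sum_weight)
  finally have "\<forall>k\<in>L. weight k t * (u (gl R k t) - m) = 0"
    using t lower stable weight_nonneg by (subst (asm) sum_nonneg_eq_0_iff[OF finite_L]) auto
  then have "u (gl R l t) = m" using l nz by (auto simp: weight_eq_0_iff)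
  then show "gl R l t \<in> {t \<in> K. u t = m}" using stable t l by blast
qed

lemma infinite_minimum_set:
  assumes only_zero: "\<And>M. finite_minimal_invariant R B L \<alpha> M \<Longrightarrow> M = {0}"
    and fixed: "transfer u = u" and le_1: "\<And>t. u t \<le> 1" and u_0: "u 0 = 1"
    and A: "0 < A" "max_abs L \<le> A"
    and min: "s \<in> {-A..A}" "\<And>t. t \<in> {-A..A} \<Longrightarrow> u s \<le> u t"
  shows "infinite {t \<in> {-A..A}. u t = u s}" (is "infinite ?Z")
proof
  assume finite: "finite ?Z"
  have "\<bar>real_of_int l\<bar> \<le> A" if "l \<in> L" for l
    using abs_le_max_abs[OF finite_L that] A(2) by linarith
  then have invariant: "invariant_set R B L \<alpha> ?Z"
    using min(2) by (intro minimum_set_invariant fixed gl_in_symmetric_interval)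
  have "?Z \<noteq> {}" using min(1) by blast
  from finite_invariant_set_contains_minimal[OF finite this invariant]
  obtain M where "M \<subseteq> ?Z" "finite_minimal_invariant R B L \<alpha> M" by blast
  then have "0 \<in> ?Z" using only_zero by blast
  then have "u s = 1" using u_0 by simp
  then have "?Z = {-A..A}" using min(2) le_1 by (auto intro: antisym)
  then show False using finite A(1) infinite_Icc[of "-A" A] by simp
qed

theorem entire_transfer_fixed_point_eq_1:
  assumes only_zero: "\<And>M. finite_minimal_invariant R B L \<alpha> M \<Longrightarrow> M = {0}"
    and entire: "h holomorphic_on UNIV" and real: "\<And>t. h (of_real t) = of_real (u t)"
    and fixed: "transfer u = u" and le_1: "\<And>t. u t \<le> 1" and u_0: "u 0 = 1"
  shows "h = (\<lambda>_. 1)"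
proof -
  define A where "A = max_abs L + 1"
  have A: "0 < A" "max_abs L \<le> A"
    using abs_le_max_abs[OF finite_L zero_in_L] by (simp_all add: A_def)
  have "continuous_on {-A..A} (\<lambda>t. h (complex_of_real t))"
    using holomorphic_on_imp_continuous_on[OF entire]
    by (rule continuous_on_compose2) (auto intro: continuous_intros)
  then have "continuous_on {-A..A} u" using continuous_on_Re by (fastforce simp: real)
  then obtain s where s: "s \<in> {-A..A}" "\<And>t. t \<in> {-A..A} \<Longrightarrow> u s \<le> u t"
    using continuous_attains_inf[of "{-A..A}" u] A(1) by force
  define K where "K = complex_of_real ` {-A..A}"
  have "complex_of_real ` {t \<in> {-A..A}. u t = u s} \<subseteq> {z \<in> K. h z = of_real (u s)}"
    by (auto simp: K_def real)
  moreover have "infinite (complex_of_real ` {t \<in> {-A..A}. u t = u s})"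
    using infinite_minimum_set[OF only_zero fixed le_1 u_0 A s]
    by (simp add: finite_image_iff inj_on_def)
  ultimately have "infinite {z \<in> K. h z = of_real (u s)}" by (rule infinite_super)
  moreover have "compact K"
    unfolding K_def by (intro compact_continuous_image continuous_intros) auto
  ultimately have const: "h z = of_real (u s)" for z
    using holomorphic_eq_const_if_infinite_level_set[OF entire] by auto
  have "h 0 = 1" using real[of 0] u_0 by simp
  then show ?thesis using const by auto
qed

corollary entire_fixed_point_eq_1:
  assumes only_zero: "\<And>M. finite_minimal_invariant R B L \<alpha> M \<Longrightarrow> M = {0}"
    and entire: "h holomorphic_on UNIV" and h_0: "h 0 = 1"
    and real: "\<And>t::real. h (of_real t) \<in> \<real>" and le_1: "\<And>t::real. Re (h (of_real t)) \<le> 1"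
    and fixed: "\<And>t. (\<Sum>l\<in>L. of_real (weight l t) * h (of_real (gl R l t))) = h (of_real t)"
  shows "h = (\<lambda>_. 1)"
proof -
  define u where "u t = Re (h (of_real t))" for t
  have h_real: "h (of_real t) = of_real (u t)" for t using real by (simp add: u_def)
  have "transfer u t = u t" for t
  proof -
    have "of_real (transfer u t) = (of_real (u t) :: complex)"
      using fixed[of t] by (simp add: transfer_def h_real)
    then show ?thesis by simp
  qed
  then have u_fixed: "transfer u = u" by blast
  have "u t \<le> 1" "u 0 = 1" for t using le_1 h_0 by (simp_all add: u_def)
  with only_zero entire h_real u_fixed show ?thesis by (rule entire_transfer_fixed_point_eq_1)
qed

section \<open>Parseval's identity\<close>

text \<open>The second factor is holomorphic in \<open>z\<close> because it is conjugated twice.\<close>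

definition entire_energy :: "nat \<Rightarrow> complex \<Rightarrow> complex" where
  "entire_energy n z = (\<Sum>w\<in>words L n. L2_inner \<mu> (cexpo z) (frame_elem R \<alpha> w)
     * cnj (L2_inner \<mu> (cexpo (cnj z)) (frame_elem R \<alpha> w)))"

lemma entire_energy_holomorphic: "entire_energy n holomorphic_on UNIV"
proof -
  have "(\<lambda>z. fourier (g z)) holomorphic_on UNIV" if "g holomorphic_on UNIV" for g
    using holomorphic_on_compose_gen[OF that fourier_entire] by (simp add: comp_def)
  note this [holomorphic_intros]
  show ?thesis
    unfolding entire_energy_def L2_inner_cexpo_frame_elem
    by (simp add: cnj_fourier) (intro holomorphic_intros)
qed

lemma entire_energy_of_real: "entire_energy n (of_real t) = of_real (frame_energy n (expo t))"
  by (simp add: entire_energy_def frame_energy_def cexpo_of_real complex_norm_square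
      del: of_real_power)

lemma cmod_entire_energy_le:
  assumes "cmod z \<le> b"
  shows "cmod (entire_energy n z) \<le> (exp (2 * pi * b * (max_abs B + 1)))\<^sup>2"
proof -
  define F where "F z w = cmod (L2_inner \<mu> (cexpo z) (frame_elem R \<alpha> w))" for z w
  have energy_le: "frame_energy n (cexpo y) \<le> (exp (2 * pi * b * (max_abs B + 1)))\<^sup>2"
    if y: "cmod y \<le> b" for y
  proof -
    have "frame_energy n (cexpo y) \<le> L2_normsq \<mu> (cexpo y)"
      by (rule frame_energy_le_normsq[OF cexpo_L2])
    also have "\<dots> \<le> (exp (2 * pi * cmod y * (max_abs B + 1)))\<^sup>2"
      using L2_normsq_cexpo_le[of y] prob_space by simp
    also have "\<dots> \<le> (exp (2 * pi * b * (max_abs B + 1)))\<^sup>2"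
      using y max_abs_B_nonneg by (intro power_mono) (auto intro!: mult_right_mono)
    finally show ?thesis .
  qed
  have "F z w * F (cnj z) w \<le> ((F z w)\<^sup>2 + (F (cnj z) w)\<^sup>2) / 2" for w
    using sum_squares_bound[of "F z w" "F (cnj z) w"] by simp
  then have "(\<Sum>w\<in>words L n. F z w * F (cnj z) w)
      \<le> (\<Sum>w\<in>words L n. ((F z w)\<^sup>2 + (F (cnj z) w)\<^sup>2) / 2)" by (rule sum_mono)
  also have "\<dots> = (frame_energy n (cexpo z) + frame_energy n (cexpo (cnj z))) / 2"
    by (simp add: F_def frame_energy_def sum.distrib flip: sum_divide_distrib)
  also have "\<dots> \<le> (exp (2 * pi * b * (max_abs B + 1)))\<^sup>2"
    using energy_le[of z] energy_le[of "cnj z"] assms by simp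
  finally show ?thesis
    unfolding entire_energy_def F_def by (intro order.trans[OF norm_sum]) (simp add: norm_mult)
qed

lemma frame_energy_expo_le_1: "frame_energy n (expo t) \<le> 1"
  using frame_energy_le_normsq[OF expo_L2, of n t] by (simp add: L2_normsq_expo)

lemma frame_energy_expo_0: "frame_energy n (expo 0) = 1"
proof (rule antisym)
  have "frame_energy 0 (expo 0) = 1"
    using prob_space by (simp add: frame_energy_0 L2_inner_def)
  then show "1 \<le> frame_energy n (expo 0)"
    using incseqD[OF incseq_frame_energy, of 0 n "expo 0"] by simp
qed (rule frame_energy_expo_le_1)

lemma frame_energy_expo_Suc:
  "frame_energy (Suc n) (expo t) = transfer (\<lambda>s. frame_energy n (expo s)) t"
  by (simp add: frame_energy_Suc[OF expo_L2] cuntz_adjoint_expo frame_energy_scale transfer_def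
      weight_def norm_mult power_mult_distrib)

definition limit_energy :: "real \<Rightarrow> real" where
  "limit_energy t = lim (\<lambda>n. frame_energy n (expo t))"

lemma frame_energy_tendsto: "(\<lambda>n. frame_energy n (expo t)) \<longlonglongrightarrow> limit_energy t"
proof -
  obtain s where "(\<lambda>n. frame_energy n (expo t)) \<longlonglongrightarrow> s"
    using incseq_convergent[OF incseq_frame_energy] frame_energy_expo_le_1 by metis
  then show ?thesis by (simp add: limit_energy_def limI)
qed

lemma limit_energy_le_1: "limit_energy t \<le> 1"
  by (rule LIMSEQ_le_const2[OF frame_energy_tendsto]) (auto simp: frame_energy_expo_le_1)

lemma limit_energy_0: "limit_energy 0 = 1"
  by (simp add: limit_energy_def frame_energy_expo_0)

lemma transfer_limit_energy: "transfer limit_energy = limit_energy"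
proof
  fix t
  have "(\<lambda>n. frame_energy (Suc n) (expo t)) \<longlonglongrightarrow> transfer limit_energy t"
    unfolding frame_energy_expo_Suc transfer_def by (intro tendsto_intros frame_energy_tendsto)
  then show "transfer limit_energy t = limit_energy t"
    using LIMSEQ_Suc[OF frame_energy_tendsto] by (rule LIMSEQ_unique)
qed

lemma limit_energy_entire_extension:
  obtains h where "h holomorphic_on UNIV" "\<And>t. h (of_real t) = of_real (limit_energy t)"
proof -
  have bounded: "\<exists>C. \<forall>h\<in>range entire_energy. \<forall>z\<in>K. cmod (h z) \<le> C" if K: "compact K" for K
  proof -
    obtain b where "\<And>z. z \<in> K \<Longrightarrow> cmod z \<le> b"
      using compact_imp_bounded[OF K] unfolding bounded_iff by blast
    then show ?thesis using cmod_entire_energy_le by blast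
  qed
  obtain h k where h: "h holomorphic_on UNIV" and k: "strict_mono (k :: nat \<Rightarrow> nat)"
      and lim: "\<And>z. (\<lambda>n. entire_energy (k n) z) \<longlonglongrightarrow> h z"
  proof (rule Montel[of UNIV "range entire_energy" entire_energy])
    show "h holomorphic_on UNIV" if "h \<in> range entire_energy" for h
      using that entire_energy_holomorphic by blast
  qed (use bounded in simp_all)
  have "h (of_real t) = of_real (limit_energy t)" for t
  proof -
    have "(\<lambda>n. entire_energy (k n) (of_real t)) \<longlonglongrightarrow> of_real (limit_energy t)"
      unfolding entire_energy_of_real
      by (intro tendsto_of_real LIMSEQ_subseq_LIMSEQ[OF frame_energy_tendsto k, unfolded comp_def])
    with lim show ?thesis by (rule LIMSEQ_unique)
  qed
  with h show ?thesis by (rule that)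
qed

theorem parseval_frame_if_only_zero_minimal:
  assumes only_zero: "\<And>M. finite_minimal_invariant R B L \<alpha> M \<Longrightarrow> M = {0}"
  shows "parseval_frame \<mu> (Omega L) (frame_elem R \<alpha>)"
proof -
  obtain h where h: "h holomorphic_on UNIV" "\<And>t. h (of_real t) = of_real (limit_energy t)"
    using limit_energy_entire_extension by blast
  have "h = (\<lambda>_. 1)"
    using only_zero h transfer_limit_energy limit_energy_le_1 limit_energy_0
    by (rule entire_transfer_fixed_point_eq_1)
  then have "limit_energy t = 1" for t using h(2)[of t] by simp
  then have "(\<lambda>n. frame_defect n (expo t)) \<longlonglongrightarrow> 1 - 1" for t
    unfolding frame_defect_def L2_normsq_expo
    using frame_energy_tendsto[of t] by (intro tendsto_intros) simp
  then have "expo t \<in> parseval_functions" for t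
    by (simp add: parseval_functions_def expo_L2)
  then interpret exponential_subspace \<mu> "max_abs B + 1" parseval_functions
    using closed_L2_subspace_parseval_functions compactly_supported_measure_axioms
    by (simp add: exponential_subspace_def exponential_subspace_axioms_def)
  show ?thesis
    unfolding parseval_frame_def eq_L2[symmetric] by (simp add: has_sum_parseval_function)
qed

section \<open>Orthogonality to nonzero minimal invariant sets\<close>

lemma invariant_set_singleton_0: "invariant_set R B L \<alpha> {0}"
  unfolding invariant_set_def
proof (intro ballI impI)
  fix t :: real and l
  assume t: "t \<in> {0}" and l: "l \<in> L" and nz: "\<alpha> l * mB B (gl R l t) \<noteq> 0"
  have "weight 0 0 = 1" using card_B_pos by (simp add: weight_def alpha_0 gl_def mB_def)
  then have "(\<Sum>k\<in>L - {0}. weight k 0) = 0"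
    using sum_weight[of 0] sum.remove[OF finite_L zero_in_L, of "\<lambda>k. weight k 0"] by simp
  then have "\<forall>k\<in>L - {0}. weight k 0 = 0"
    using finite_L weight_nonneg by (subst (asm) sum_nonneg_eq_0_iff) auto
  then have "l = 0" using l t nz by (auto simp: weight_eq_0_iff)
  then show "gl R l t \<in> {0}" using t by (simp add: gl_def)
qed

lemma zero_notin_minimal_invariant:
  assumes "finite_minimal_invariant R B L \<alpha> M" "M \<noteq> {0}"
  shows "0 \<notin> M"
proof
  assume "0 \<in> M"
  with assms(2) have "{0} \<subset> M" by blast
  then show False
    using assms(1) invariant_set_singleton_0 by (auto simp: finite_minimal_invariant_def)
qed

text \<open>If \<open>c\<close> had a nonzero Fourier coefficient, the digit \<open>0\<close> would lead from \<open>c\<close> to \<open>c / R\<close>, which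
  again lies in \<open>M\<close> and has a nonzero coefficient; iterating makes \<open>M\<close> infinite.\<close>

lemma fourier_minimal_invariant_eq_0:
  assumes M: "finite_minimal_invariant R B L \<alpha> M" "M \<noteq> {0}" and c: "c \<in> M"
  shows "fourier (of_real c) = 0"
proof (rule ccontr)
  assume nz: "fourier (of_real c) \<noteq> 0"
  have "c / of_int R ^ n \<in> M \<and> fourier (of_real (c / of_int R ^ n)) \<noteq> 0" for n
  proof (induction n)
    case (Suc n)
    have c_Suc: "gl R 0 (c / of_int R ^ n) = c / of_int R ^ Suc n"
      "c / of_int R ^ n / R = c / of_int R ^ Suc n"
      by (simp_all add: gl_def)
    have "mB B (c / of_int R ^ Suc n) \<noteq> 0" "fourier (of_real (c / of_int R ^ Suc n)) \<noteq> 0"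
      using Suc fourier_refinement[of "c / of_int R ^ n"] unfolding c_Suc by auto
    moreover from this(1) have "c / of_int R ^ Suc n \<in> M"
      using M(1) Suc zero_in_L alpha_0 c_Suc(1)
      unfolding finite_minimal_invariant_def invariant_set_def by fastforce
    ultimately show ?case by blast
  qed (use c nz in simp)
  then have "range (\<lambda>n. c / of_int R ^ n) \<subseteq> M" by blast
  moreover have "c \<noteq> 0" using zero_notin_minimal_invariant[OF M] c by blast
  then have "infinite (range (\<lambda>n. c / of_int R ^ n))"
    using abs_real_R_ge_2 by (intro range_inj_infinite inj_divide_power) auto
  ultimately have "infinite M" by (rule infinite_super)
  then show False using M(1) by (simp add: finite_minimal_invariant_def)
qed

theorem expo_minimal_invariant_orthogonal:
  assumes M: "finite_minimal_invariant R B L \<alpha> M" "M \<noteq> {0}"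
  shows "c \<in> M \<Longrightarrow> set w \<subseteq> L \<Longrightarrow> L2_inner \<mu> (expo c) (frame_elem R \<alpha> w) = 0"
proof (induction w arbitrary: c)
  case Nil
  then show ?case
    using fourier_minimal_invariant_eq_0[OF M] by (simp add: frame_elem_Nil fourier_of_real)
next
  case (Cons l w)
  have step: "L2_inner \<mu> (expo c) (frame_elem R \<alpha> (l # w))
      = cnj (\<alpha> l) * mB B (gl R l c) * L2_inner \<mu> (expo (gl R l c)) (frame_elem R \<alpha> w)"
    by (simp add: L2_inner_frame_elem_Cons[OF expo_L2] cuntz_adjoint_expo L2_inner_scale_left)
  show ?case
  proof (cases "\<alpha> l * mB B (gl R l c) = 0")
    case True
    then show ?thesis by (auto simp: step)
  next
    case False
    then have "gl R l c \<in> M"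
      using M(1) Cons.prems by (auto simp: finite_minimal_invariant_def invariant_set_def)
    then show ?thesis using Cons by (simp add: step)
  qed
qed

end

theorem theorem4p4:
  fixes R :: int and B L :: "int set" and \<alpha> :: "int \<Rightarrow> complex" and \<mu> :: "real measure"
  assumes R: "\<bar>R\<bar> \<ge> 2"
    and B: "finite B" "0 \<in> B"
    and mu: "invariant_measure R B \<mu>"
    and nov: "no_overlap R B \<mu>"
    and L: "finite L" "0 \<in> L"
    and a0: "\<alpha> 0 = 1"
    and orth: "\<forall>b\<in>B. \<forall>b'\<in>B.
       (\<Sum>l\<in>L. (1 / of_nat (card B)) *
          (expo (real_of_int l * real_of_int b / real_of_int R) 1 * \<alpha> l) *
          cnj (expo (real_of_int l * real_of_int b' / real_of_int R) 1 * \<alpha> l))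
       = (if b = b' then 1 else 0)"
  shows "((\<forall>M. finite_minimal_invariant R B L \<alpha> M \<longrightarrow> M = {0}) \<longrightarrow>
            (\<forall>h :: complex \<Rightarrow> complex.
               h holomorphic_on UNIV \<and>
               (\<forall>t::real. h (of_real t) \<in> \<real> \<and> 0 \<le> Re (h (of_real t)) \<and> Re (h (of_real t)) \<le> 1) \<and>
               h 0 = 1 \<and>
               (\<forall>t::real. (\<Sum>l\<in>L. complex_of_real ((cmod (\<alpha> l))\<^sup>2 * (cmod (mB B (gl R l t)))\<^sup>2)
                                   * h (of_real (gl R l t))) = h (of_real t))
               \<longrightarrow> h = (\<lambda>_. 1))
            \<and> parseval_frame \<mu> (Omega L) (frame_elem R \<alpha>))
       \<and> (\<forall>M. finite_minimal_invariant R B L \<alpha> M \<and> M \<noteq> {0} \<longrightarrow>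
            (\<forall>c\<in>M. \<forall>w\<in>Omega L. L2_inner \<mu> (expo c) (frame_elem R \<alpha> w) = 0))"
proof -
  interpret ifs_frame R B \<mu> L \<alpha>
    by (intro ifs_frame.intro ifs_measure.intro ifs_frame_axioms.intro assms)
  show ?thesis
  proof (intro conjI impI allI ballI)
    fix h :: "complex \<Rightarrow> complex"
    assume only_zero: "\<forall>M. finite_minimal_invariant R B L \<alpha> M \<longrightarrow> M = {0}"
    assume h: "h holomorphic_on UNIV \<and>
       (\<forall>t::real. h (of_real t) \<in> \<real> \<and> 0 \<le> Re (h (of_real t)) \<and> Re (h (of_real t)) \<le> 1) \<and>
       h 0 = 1 \<and>
       (\<forall>t::real. (\<Sum>l\<in>L. complex_of_real ((cmod (\<alpha> l))\<^sup>2 * (cmod (mB B (gl R l t)))\<^sup>2)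
                           * h (of_real (gl R l t))) = h (of_real t))"
    show "h = (\<lambda>_. 1)"
      using only_zero h by (intro entire_fixed_point_eq_1) (auto simp: weight_def)
  next
    assume "\<forall>M. finite_minimal_invariant R B L \<alpha> M \<longrightarrow> M = {0}"
    then show "parseval_frame \<mu> (Omega L) (frame_elem R \<alpha>)"
      by (intro parseval_frame_if_only_zero_minimal) blast
  next
    fix M c w
    assume "finite_minimal_invariant R B L \<alpha> M \<and> M \<noteq> {0}" "c \<in> M" "w \<in> Omega L"
    then show "L2_inner \<mu> (expo c) (frame_elem R \<alpha> w) = 0"
      using expo_minimal_invariant_orthogonal by (auto simp: Omega_def)
  qed
qed

end
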